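(* Let $n\ge1$ and let $\psi$ be a non-negative increasing function on $[0,\infty)$ such that $\psi(x)\to\infty$ as $x\to\infty$. Then the following two conditions are equivalent: (i) for every set $\Lambda=\Lambda_1\times\cdots\times\Lambda_n\subset\mathbb{T}^n$, where each $\Lambda_j\subset\mathbb{T}$ is a set of positive Lebesgue measure, $\Phi_\Lambda(\mathbb{Z}^n)$ is a dense subspace of $(c_\psi(\mathbb{Z}^n),\|\cdot\|_\psi)$; (ii) $\displaystyle\sum_{k=0}^\infty\frac{\psi(k)}{1+k^2}=\infty$.
   Context: $\mathbb{T}^n$ is the $n$-dimensional torus, identified with $[-\pi,\pi)^n$ and carrying Lebesgue measure; sets of positive measure are Lebesgue measurable. $|k|$ is the Euclidean norm. "Increasing" means $x\le y\Rightarrow\psi(x)\le\psi(y)$. $c_\psi(\mathbb{Z}^n)$ is the space of complex families $(a_k)_{k\in\mathbb{Z}^n}$ with $\lim_{|k|\to\infty}a_k/e^{\psi(|k|)}=0$, with norm $\|(a_k)\|_\psi=\sup_{k\in\mathbb{Z}^n}|a_k|/e^{\psi(|k|)}$. For $\Lambda\subset\mathbb{T}^n$, $\Phi_\Lambda(\mathbb{Z}^n)$ is the complex linear span of $\{E_\lambda:\lambda\in\Lambda\}$, where $E_\lambda=(e^{i\lambda\cdot k})_{k\in\mathbb{Z}^n}$. *)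

theory Defs
  imports "HOL-Analysis.Analysis" "HOL-Library.Function_Algebras"
begin

section \<open>The torus\<close>

definition torus1 :: "real set" where
  "torus1 = {-pi..<pi}"

text \<open>For a family \<open>L\<close> of subsets of \<^const>\<open>torus1\<close>, this is the product
  $L_1 \times \cdots \times L_n$ as a subset of the \<open>n\<close>-dimensional torus,
  itself identified with $[-\pi,\pi)^n$.\<close>

definition box_product :: "('n::finite \<Rightarrow> real set) \<Rightarrow> (real ^ 'n) set" where
  "box_product L = {x. \<forall>j. x $ j \<in> L j}"


section \<open>The weighted space of complex families on the integer lattice\<close>

definition lattice_vec :: "int ^ 'n \<Rightarrow> real ^ 'n" where
  "lattice_vec k = (\<chi> j. of_int (k $ j))"

definition lattice_norm :: "int ^ 'n::finite \<Rightarrow> real" where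
  "lattice_norm k = norm (lattice_vec k)"

definition c_space :: "(real \<Rightarrow> real) \<Rightarrow> (int ^ 'n::finite \<Rightarrow> complex) set" where
  "c_space \<psi> = {a. ((\<lambda>k. a k / of_real (exp (\<psi> (lattice_norm k)))) \<longlongrightarrow> 0)
                     (filtercomap lattice_norm at_top)}"

definition c_norm :: "(real \<Rightarrow> real) \<Rightarrow> (int ^ 'n::finite \<Rightarrow> complex) \<Rightarrow> real" where
  "c_norm \<psi> a = (SUP k. cmod (a k) / exp (\<psi> (lattice_norm k)))"

text \<open>Off \<^const>\<open>c_space\<close> the supremum may be over an unbounded set and hence carries no
  meaning, while the locale \<^locale>\<open>Metric_space\<close> demands a nonnegative total function;
  so the norm distance is set to \<open>0\<close> there.\<close>

definition c_dist ::
    "(real \<Rightarrow> real) \<Rightarrow> (int ^ 'n::finite \<Rightarrow> complex) \<Rightarrow> (int ^ 'n \<Rightarrow> complex) \<Rightarrow> real" where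
  "c_dist \<psi> a b = (if a \<in> c_space \<psi> \<and> b \<in> c_space \<psi> then c_norm \<psi> (a - b) else 0)"

lemma finite_lattice_ball: "finite {k :: int ^ 'n::finite. lattice_norm k < r}"
proof -
  have "vec_nth ` {k :: int ^ 'n. lattice_norm k < r} \<subseteq> (UNIV :: 'n set) \<rightarrow>\<^sub>E {-\<lceil>r\<rceil>..\<lceil>r\<rceil>}"
  proof (clarsimp simp: PiE_def)
    fix k :: "int ^ 'n" and j
    assume "lattice_norm k < r"
    then have "\<bar>real_of_int (k $ j)\<bar> < r"
      using component_le_norm_cart[of "lattice_vec k" j]
      by (simp add: lattice_norm_def lattice_vec_def)
    then show "- \<lceil>r\<rceil> \<le> k $ j \<and> k $ j \<le> \<lceil>r\<rceil>" by linarith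
  qed
  moreover have "finite ((UNIV :: 'n set) \<rightarrow>\<^sub>E {-\<lceil>r\<rceil>..\<lceil>r\<rceil>})"
    by (intro finite_PiE) auto
  moreover have "inj_on vec_nth {k :: int ^ 'n. lattice_norm k < r}"
    by (auto simp: inj_on_def vec_nth_inject)
  ultimately show ?thesis
    using finite_imageD finite_subset by blast
qed

lemma c_space_bdd:
  assumes "a \<in> c_space \<psi>"
  shows "bdd_above (range (\<lambda>k. cmod (a k) / exp (\<psi> (lattice_norm k))))"
proof -
  let ?f = "\<lambda>k. cmod (a k) / exp (\<psi> (lattice_norm k))"
  have "\<forall>\<^sub>F k in filtercomap lattice_norm at_top.
      dist (a k / of_real (exp (\<psi> (lattice_norm k)))) 0 < 1"
    using assms unfolding c_space_def by (intro tendstoD) auto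
  then obtain r where r: "\<And>k. lattice_norm k \<ge> r \<Longrightarrow> ?f k < 1"
    by (auto simp: eventually_filtercomap eventually_at_top_linorder norm_divide)
  have "range ?f \<subseteq> ?f ` {k. lattice_norm k < r} \<union> {..1}"
  proof (rule image_subsetI)
    fix k
    show "?f k \<in> ?f ` {k. lattice_norm k < r} \<union> {..1}"
    proof (cases "lattice_norm k < r")
      case False
      then show ?thesis using r[of k] by simp
    qed blast
  qed
  moreover have "bdd_above (?f ` {k. lattice_norm k < r} \<union> {..1})"
    by (simp add: bdd_above_finite finite_lattice_ball)
  ultimately show ?thesis by (rule bdd_above_mono[rotated])
qed

lemma c_space_diff: "a \<in> c_space \<psi> \<Longrightarrow> b \<in> c_space \<psi> \<Longrightarrow> a - b \<in> c_space \<psi>"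
proof -
  assume "a \<in> c_space \<psi>" "b \<in> c_space \<psi>"
  then show ?thesis
    using tendsto_diff[of "\<lambda>k. a k / of_real (exp (\<psi> (lattice_norm k)))" 0
        "filtercomap lattice_norm at_top" "\<lambda>k. b k / of_real (exp (\<psi> (lattice_norm k)))" 0]
    by (simp add: c_space_def diff_divide_distrib)
qed

lemma c_norm_le:
  assumes "\<And>k. cmod (a k) / exp (\<psi> (lattice_norm k)) \<le> B"
  shows "c_norm \<psi> a \<le> B"
  unfolding c_norm_def using assms by (intro cSUP_least) auto

lemma c_norm_ge:
  assumes "a \<in> c_space \<psi>"
  shows "cmod (a k) / exp (\<psi> (lattice_norm k)) \<le> c_norm \<psi> a"
  unfolding c_norm_def using c_space_bdd[OF assms] by (intro cSUP_upper) auto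

interpretation c_space: Metric_space "c_space \<psi> :: (int ^ 'n::finite \<Rightarrow> complex) set" "c_dist \<psi>" for \<psi>
proof
  fix a b c :: "int ^ 'n \<Rightarrow> complex"
  show "0 \<le> c_dist \<psi> a b"
  proof (cases "a \<in> c_space \<psi> \<and> b \<in> c_space \<psi>")
    case True
    fix k0 :: "int ^ 'n"
    have "0 \<le> cmod ((a - b) k0) / exp (\<psi> (lattice_norm k0))" by simp
    also have "\<dots> \<le> c_norm \<psi> (a - b)"
      using True by (intro c_norm_ge c_space_diff) auto
    finally show ?thesis using True by (simp add: c_dist_def)
  qed (auto simp: c_dist_def)
  show "c_dist \<psi> a b = c_dist \<psi> b a"
    by (simp add: c_dist_def c_norm_def norm_minus_commute)
  assume a: "a \<in> c_space \<psi>" and b: "b \<in> c_space \<psi>"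
  show "c_dist \<psi> a b = 0 \<longleftrightarrow> a = b"
  proof
    assume "c_dist \<psi> a b = 0"
    then have "cmod ((a - b) k) / exp (\<psi> (lattice_norm k)) \<le> 0" for k
      using c_norm_ge[OF c_space_diff[OF a b], of k] a b by (simp add: c_dist_def)
    then show "a = b"
      by (auto simp: fun_eq_iff divide_le_0_iff)
  next
    assume "a = b"
    then show "c_dist \<psi> a b = 0" by (simp add: c_dist_def c_norm_def)
  qed
  assume c: "c \<in> c_space \<psi>"
  have "c_norm \<psi> (a - c) \<le> c_norm \<psi> (a - b) + c_norm \<psi> (b - c)"
  proof (rule c_norm_le)
    fix k
    have "cmod ((a - c) k) / exp (\<psi> (lattice_norm k)) \<le>
        cmod ((a - b) k) / exp (\<psi> (lattice_norm k)) + cmod ((b - c) k) / exp (\<psi> (lattice_norm k))"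
      using norm_triangle_ineq[of "a k - b k" "b k - c k"]
      by (simp add: divide_right_mono flip: add_divide_distrib)
    also have "\<dots> \<le> c_norm \<psi> (a - b) + c_norm \<psi> (b - c)"
      by (intro add_mono c_norm_ge c_space_diff a b c)
    finally show "cmod ((a - c) k) / exp (\<psi> (lattice_norm k)) \<le>
        c_norm \<psi> (a - b) + c_norm \<psi> (b - c)" .
  qed
  then show "c_dist \<psi> a c \<le> c_dist \<psi> a b + c_dist \<psi> b c"
    using a b c by (simp add: c_dist_def)
qed


section \<open>Complex span of exponential families\<close>

definition cscale :: "complex \<Rightarrow> ('a \<Rightarrow> complex) \<Rightarrow> 'a \<Rightarrow> complex" where
  "cscale c f = (\<lambda>k. c * f k)"

interpretation cfun: vector_space cscale
  by unfold_locales (auto simp: cscale_def fun_eq_iff algebra_simps)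

definition exp_family :: "real ^ 'n::finite \<Rightarrow> int ^ 'n \<Rightarrow> complex" where
  "exp_family l = (\<lambda>k. exp (\<i> * of_real (l \<bullet> lattice_vec k)))"

definition exp_span :: "(real ^ 'n::finite) set \<Rightarrow> (int ^ 'n \<Rightarrow> complex) set" where
  "exp_span \<Lambda> = cfun.span (exp_family ` \<Lambda>)"

definition dense_subspace ::
    "(real \<Rightarrow> real) \<Rightarrow> (int ^ 'n::finite \<Rightarrow> complex) set \<Rightarrow> bool" where
  "dense_subspace \<psi> S \<longleftrightarrow>
     cfun.subspace S \<and> S \<subseteq> c_space \<psi> \<and> c_space.mtopology \<psi> closure_of S = c_space \<psi>"

lemma dense_subspace_iff:
  "dense_subspace \<psi> S \<longleftrightarrow> cfun.subspace S \<and> S \<subseteq> c_space \<psi> \<and>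
     (\<forall>a\<in>c_space \<psi>. \<forall>\<epsilon>>0. \<exists>f\<in>S. c_norm \<psi> (a - f) < \<epsilon>)"
proof -
  have "c_space.mtopology \<psi> closure_of S = c_space \<psi> \<longleftrightarrow>
      (\<forall>a\<in>c_space \<psi>. \<forall>\<epsilon>>0. \<exists>f\<in>S. c_norm \<psi> (a - f) < \<epsilon>)" if "S \<subseteq> c_space \<psi>"
  proof -
    have "(f \<in> c_space.mball \<psi> a \<epsilon>) \<longleftrightarrow> c_norm \<psi> (a - f) < \<epsilon>"
      if "a \<in> c_space \<psi>" "f \<in> S" for a f \<epsilon>
      using that \<open>S \<subseteq> c_space \<psi>\<close> by (auto simp: c_dist_def)
    then have "c_space.mtopology \<psi> closure_of S =
        {a \<in> c_space \<psi>. \<forall>\<epsilon>>0. \<exists>f\<in>S. c_norm \<psi> (a - f) < \<epsilon>}"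
      unfolding c_space.metric_closure_of by blast
    then show ?thesis by blast
  qed
  then show ?thesis
    unfolding dense_subspace_def by blast
qed

end

theory Submission
  imports Defs
begin

text \<open>The dual of the weighted \<open>c\<^sub>0\<close> space consists of the families \<open>b\<close> with
  \<open>sum \<bar>b k\<bar> exp (\<psi> \<bar>k\<bar>)\<close> finite, so density amounts to uniqueness: a Fourier series with such
  coefficients that vanishes on a set \<open>E\<close> of positive measure is zero. Products reduce
  everything to dimension one.

  Divergence implies uniqueness. The partial sum of order \<open>N\<close> is at most \<open>exp (- \<psi> N)\<close> on \<open>E\<close>.
  On an interval of length about \<open>\<psi> N / N\<close> it is a polynomial of degree about \<open>\<psi> N\<close> up to
  an exponentially small error, so Lagrange interpolation spreads the smallness from a subset of
  positive proportion to the whole interval, with a fixed fraction of the exponent lost. Along a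
  sequence \<open>N\<^sub>j\<close> on which \<open>\<psi>\<close> grows geometrically this loss is harmless. Descending in
  \<open>j\<close> from a density point of \<open>E\<close>, the interval on which the partial sum is small grows by about
  \<open>\<psi> N\<^sub>j / N\<^sub>j\<close> at every step; these lengths have infinite sum, so all of the line is covered.

  Convergence implies non-uniqueness. An infinite convolution of intervals, whose coefficients are
  products of \<open>(sin (a k) / (a k))\<^sup>2\<close>, is supported near \<open>0\<close> and has coefficients as small as
  \<open>exp (- \<psi> \<bar>k\<bar>)\<close>.\<close>

section \<open>Interpolation of exponential sums\<close>

text \<open>Smallness on \<open>E\<close> cannot be carried to the whole line at one scale, since
  the weight need not force analyticity. At scale \<open>N\<close> the admissible length is about
  \<open>p / N\<close> with \<open>p\<close> proportional to \<open>\<psi> N\<close>: there,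
  frequencies up to \<open>N\<close> are Taylor polynomials of degree below \<open>p\<close> up to
  an exponentially small error. Interpolation at \<open>p\<close> points spread over a proportion
  \<open>\<eta>\<close> of such an interval costs a factor
  \<open>(2 e / \<eta>) ^ p \<le> exp (K p)\<close>. The growth ratio \<open>K + 2\<close> of the
  scales pays for it: the bound \<open>exp (- p)\<close> reached at one scale is at most the bound
  \<open>exp (- (K + 2) p)\<close> required at the next coarser one. Divergence passes to the sum of
  \<open>p / N\<close> over the scales because each block of the series is at most a constant times
  one such quotient. In the other direction the kernel is handled through its coefficients only.
  Vanishing away from 0 is recorded as boundedness of unnormalised Cesaro sums; this survives
  averaging and limits of the coefficients, and for an absolutely convergent series it forces the
  value 0.\<close>

text \<open>Greedy selection from the left: take a point near the infimum, discard everything closer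
  than \<open>g\<close> to its right, and repeat.\<close>

lemma spaced_points:
  fixes G :: "real set"
  assumes "G \<in> lmeasurable" "bounded G" "0 < g" "measure lebesgue G > real n * g"
  shows "\<exists>t. (\<forall>i\<le>n. t i \<in> G) \<and> (\<forall>i<n. t i + g \<le> t (Suc i))"
  using assms
proof (induction n arbitrary: G)
  case 0
  then have "G \<noteq> {}" by auto
  then show ?case by auto
next
  case (Suc n)
  \<comment> \<open>The excess of measure. The infimum need not be attained, so the first point is
    taken within \<open>\<delta>\<close> of it; the discarded part then has measure below
    \<open>g + \<delta>\<close>, and more than \<open>n * g\<close> remains.\<close>
  define \<delta> where "\<delta> = measure lebesgue G - real (Suc n) * g"
  have "\<delta> > 0" using Suc.prems by (simp add: \<delta>_def)
  have "G \<noteq> {}"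
  proof
    assume "G = {}"
    then have "real (Suc n) * g < 0" using Suc.prems(4) by simp
    moreover have "real (Suc n) * g \<ge> 0" using \<open>0 < g\<close> by (intro mult_nonneg_nonneg) auto
    ultimately show False by simp
  qed
  have bdd: "bdd_below G" using Suc.prems(2) by (rule bounded_imp_bdd_below)
  obtain t0 where t0: "t0 \<in> G" "t0 < Inf G + \<delta>"
    using cInf_lessD[OF \<open>G \<noteq> {}\<close>, of "Inf G + \<delta>"] \<open>\<delta> > 0\<close> by auto
  let ?G' = "G \<inter> {t0 + g..}"
  have G': "?G' \<in> lmeasurable"
    using Suc.prems(1) by (intro fmeasurable_Int_fmeasurable) auto
  have le: "Inf G \<le> t0" using bdd t0 cInf_lower by blast
  have "G \<subseteq> {Inf G..t0 + g} \<union> ?G'"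
    using cInf_lower[OF _ bdd] by force
  then have "measure lebesgue G \<le> measure lebesgue ({Inf G..t0 + g} \<union> ?G')"
    using G' Suc.prems(1) by (intro measure_mono_fmeasurable fmeasurable.Un) (auto simp: fmeasurableD)
  also have "\<dots> \<le> measure lebesgue {Inf G..t0 + g} + measure lebesgue ?G'"
    using G' by (intro measure_Un_le) (auto simp: fmeasurableD)
  finally have "measure lebesgue ?G' > real n * g"
    using t0 le \<open>0 < g\<close> by (simp add: \<delta>_def algebra_simps)
  moreover have "bounded ?G'" using Suc.prems(2) bounded_subset by blast
  ultimately obtain t where t: "\<forall>i\<le>n. t i \<in> ?G'" "\<forall>i<n. t i + g \<le> t (Suc i)"
    using Suc.IH[OF G'] \<open>0 < g\<close> by blast
  let ?t = "\<lambda>i. case i of 0 \<Rightarrow> t0 | Suc i \<Rightarrow> t i"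
  have "(\<forall>i\<le>Suc n. ?t i \<in> G) \<and> (\<forall>i<Suc n. ?t i + g \<le> ?t (Suc i))"
    using t t0 by (auto split: nat.split)
  then show ?case by blast
qed

lemma spaced_mono:
  fixes t :: "nat \<Rightarrow> real"
  assumes "\<forall>i<n. t i + g \<le> t (Suc i)" "i \<le> j" "j \<le> n"
  shows "t i + real (j - i) * g \<le> t j"
  using assms(2,3)
proof (induction j rule: dec_induct)
  case (step k)
  then have "t i + real (k - i) * g \<le> t k" by simp
  moreover have "t k + g \<le> t (Suc k)" using assms(1) step by simp
  moreover have "real (Suc k - i) * g = real (k - i) * g + g"
    using step by (simp add: Suc_diff_le algebra_simps)
  ultimately show ?case by linarith
qed simp

lemma spaced_dist:
  fixes t :: "nat \<Rightarrow> real"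
  assumes "\<forall>i<n. t i + g \<le> t (Suc i)" "0 < g" "i \<le> n" "j \<le> n"
  shows "\<bar>real i - real j\<bar> * g \<le> \<bar>t i - t j\<bar>"
proof (cases "i \<le> j")
  case True
  with spaced_mono[OF assms(1), of i j] assms show ?thesis
    by (simp add: abs_if of_nat_diff algebra_simps)
next
  case False
  with spaced_mono[OF assms(1), of j i] assms show ?thesis
    by (simp add: abs_if of_nat_diff algebra_simps)
qed

text \<open>Lagrange denominators for integer nodes; their reciprocals add up to a binomial sum in
  \<open>poly_bound_spaced\<close>.\<close>

lemma prod_index_dist:
  assumes "i \<le> n"
  shows "(\<Prod>j\<in>{..n} - {i}. \<bar>real i - real j\<bar>) = fact i * fact (n - i)"
proof -
  have split: "{..n} - {i} = {..<i} \<union> {Suc i..n}" using assms by auto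
  have "(\<Prod>j\<in>{..n} - {i}. \<bar>real i - real j\<bar>)
      = (\<Prod>j<i. \<bar>real i - real j\<bar>) * (\<Prod>j\<in>{Suc i..n}. \<bar>real i - real j\<bar>)"
    unfolding split by (rule prod.union_disjoint) auto
  also have "(\<Prod>j<i. \<bar>real i - real j\<bar>) = (\<Prod>j\<in>{1..i}. real j)"
    by (rule prod.reindex_bij_witness[of _ "\<lambda>j. i - j" "\<lambda>j. i - j"]) (auto simp: of_nat_diff)
  also have "(\<Prod>j\<in>{Suc i..n}. \<bar>real i - real j\<bar>) = (\<Prod>j\<in>{1..n - i}. real j)"
    by (rule prod.reindex_bij_witness[of _ "\<lambda>j. j + i" "\<lambda>j. j - i"]) (auto simp: of_nat_diff)
  finally show ?thesis by (simp add: fact_prod)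
qed

lemma lagrange_interpolation:
  fixes q :: "complex poly" and t :: "nat \<Rightarrow> complex"
  assumes "inj_on t {..n}" "degree q \<le> n"
  shows "poly q x = (\<Sum>i\<le>n. poly q (t i) * (\<Prod>j\<in>{..n} - {i}. (x - t j) / (t i - t j)))"
proof -
  define l where "l i = (\<Prod>j\<in>{..n} - {i}. smult (inverse (t i - t j)) [:- t j, 1:])" for i
  define r where "r = (\<Sum>i\<le>n. smult (poly q (t i)) (l i))"
  have pl: "poly (l i) y = (\<Prod>j\<in>{..n} - {i}. (y - t j) / (t i - t j))" for i y
    unfolding l_def poly_prod by (intro prod.cong refl) (simp add: divide_inverse algebra_simps)
  have pr: "poly r y = (\<Sum>i\<le>n. poly q (t i) * poly (l i) y)" for y
    by (simp add: r_def poly_sum)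
  have deg: "degree (l i) \<le> n" if "i \<le> n" for i
  proof -
    have "degree (l i) \<le> (\<Sum>j\<in>{..n} - {i}. degree (smult (inverse (t i - t j)) [:- t j, 1:]))"
      unfolding l_def by (rule order_trans[OF degree_prod_sum_le]) (auto simp: o_def)
    also have "\<dots> \<le> (\<Sum>j\<in>{..n} - {i}. 1)"
      by (intro sum_mono) (auto simp: degree_smult_eq)
    also have "\<dots> = n" using that by simp
    finally show ?thesis .
  qed
  have "degree r \<le> n"
    unfolding r_def by (intro degree_sum_le order_trans[OF degree_smult_le] deg) auto
  have "poly r (t k) = poly q (t k)" if "k \<le> n" for k
  proof -
    have "poly (l i) (t k) = (if i = k then 1 else 0)" if "i \<le> n" for i
    proof (cases "i = k")
      case True
      then have "t k \<noteq> t j" if "j \<in> {..n} - {k}" for j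
        using that assms(1) \<open>k \<le> n\<close> by (auto simp: inj_on_def)
      then show ?thesis using True by (auto simp: pl intro!: prod.neutral)
    next
      case False
      then show ?thesis using \<open>k \<le> n\<close> by (auto simp: pl intro!: prod_zero bexI[of _ k])
    qed
    then have "poly r (t k) = (\<Sum>i\<le>n. if i = k then poly q (t i) else 0)"
      unfolding pr by (intro sum.cong) auto
    then show ?thesis using that by simp
  qed
  then have "poly r y = poly q y" if "y \<in> t ` {..n}" for y
    using that by auto
  then have "r = q"
    using \<open>degree r \<le> n\<close> assms by (intro poly_eqI_degree[of "t ` {..n}"]) (auto simp: card_image)
  then show ?thesis using pr[of x] by (simp add: pl)
qed

text \<open>In the Lagrange basis each numerator is at most \<open>D ^ n\<close> and each
  denominator at least \<open>g ^ n\<close> times the one for integer nodes. Summing the reciprocals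
  of \<open>fact i * fact (n - i)\<close> gives \<open>2 ^ n / fact n\<close>.\<close>

lemma poly_bound_spaced:
  fixes q :: "complex poly" and t :: "nat \<Rightarrow> real"
  assumes gap: "\<forall>i<n. t i + g \<le> t (Suc i)" "0 < g"
    and t: "\<And>i. i \<le> n \<Longrightarrow> t i \<in> {a..a + D}" and x: "x \<in> {a..a + D}"
    and deg: "degree q \<le> n"
    and q: "\<And>i. i \<le> n \<Longrightarrow> cmod (poly q (of_real (t i))) \<le> \<epsilon>"
  shows "cmod (poly q (of_real x)) \<le> \<epsilon> * (2 * D / g) ^ n / fact n"
proof -
  have "D \<ge> 0" using x by auto
  have eps: "\<epsilon> \<ge> 0" using q[of 0] norm_ge_zero order_trans by blast
  have inj: "inj_on (\<lambda>i. complex_of_real (t i)) {..n}"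
  proof (rule inj_onI)
    fix i j assume *: "i \<in> {..n}" "j \<in> {..n}" "complex_of_real (t i) = of_real (t j)"
    then have "\<bar>real i - real j\<bar> * g \<le> 0"
      using spaced_dist[OF gap, of i j] by simp
    then show "i = j" using \<open>0 < g\<close> by (simp add: mult_le_0_iff)
  qed
  have "cmod (\<Prod>j\<in>{..n} - {i}. (of_real x - of_real (t j)) / (of_real (t i) - of_real (t j)))
      \<le> (D / g) ^ n / (fact i * fact (n - i))" if i: "i \<le> n" for i
  proof -
    have "cmod (\<Prod>j\<in>{..n} - {i}. (of_real x - of_real (t j)) / (of_real (t i) - of_real (t j)))
        = (\<Prod>j\<in>{..n} - {i}. \<bar>x - t j\<bar> / \<bar>t i - t j\<bar>)"
      by (simp add: norm_divide flip: prod_norm of_real_diff)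
    also have "\<dots> \<le> (\<Prod>j\<in>{..n} - {i}. D / (\<bar>real i - real j\<bar> * g))"
    proof (intro prod_mono conjI)
      fix j assume j: "j \<in> {..n} - {i}"
      have "\<bar>x - t j\<bar> \<le> D" using t[of j] x j by auto
      moreover have "\<bar>real i - real j\<bar> * g \<le> \<bar>t i - t j\<bar>"
        using spaced_dist[OF gap, of i j] i j by auto
      moreover have "\<bar>real i - real j\<bar> * g > 0" using j \<open>0 < g\<close> by auto
      ultimately show "\<bar>x - t j\<bar> / \<bar>t i - t j\<bar> \<le> D / (\<bar>real i - real j\<bar> * g)"
        using \<open>D \<ge> 0\<close> by (intro frac_le) auto
    qed auto
    also have "\<dots> = (D / g) ^ n / (\<Prod>j\<in>{..n} - {i}. \<bar>real i - real j\<bar>)"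
    proof -
      have "(\<Prod>j\<in>{..n} - {i}. D / (\<bar>real i - real j\<bar> * g))
          = (\<Prod>j\<in>{..n} - {i}. (D / g) / \<bar>real i - real j\<bar>)"
        by (simp add: field_simps)
      also have "\<dots> = (\<Prod>j\<in>{..n} - {i}. D / g) / (\<Prod>j\<in>{..n} - {i}. \<bar>real i - real j\<bar>)"
        by (rule prod_dividef)
      finally show ?thesis using i by simp
    qed
    finally show ?thesis using prod_index_dist[OF i] by simp
  qed
  note L = this
  have "cmod (poly q (of_real x)) \<le> (\<Sum>i\<le>n. \<epsilon> * ((D / g) ^ n / (fact i * fact (n - i))))"
    unfolding lagrange_interpolation[OF inj deg, of "of_real x"]
    by (rule order_trans[OF norm_sum], intro sum_mono, unfold norm_mult, intro mult_mono q L) (auto intro: eps)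
  also have "\<dots> = \<epsilon> * (D / g) ^ n * (\<Sum>i\<le>n. 1 / (fact i * fact (n - i)))"
    by (simp add: sum_distrib_left)
  also have "(\<Sum>i\<le>n. 1 / (fact i * fact (n - i) :: real)) = (\<Sum>i\<le>n. real (n choose i) / fact n)"
    by (intro sum.cong) (auto simp: binomial_fact field_simps)
  also have "\<dots> = 2 ^ n / fact n"
    by (simp flip: sum_divide_distrib of_nat_sum add: choose_row_sum)
  finally show ?thesis by (simp add: power_mult_distrib power_divide mult_ac)
qed

text \<open>One term of the exponential series; it serves as a crude Stirling bound.\<close>

lemma power_le_exp_fact: "real n ^ n \<le> exp (real n) * fact n"
proof -
  have "real n ^ n / fact n \<le> exp (real n)"
  proof -
    have "(\<lambda>k. real n ^ k / fact k) sums exp (real n)"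
      using exp_converges[of "real n"] by (simp add: field_simps)
    then show ?thesis
      using sum_le_suminf[of "\<lambda>k. real n ^ k / fact k" "{n}"] by (auto simp: sums_iff)
  qed
  then show ?thesis by (simp add: field_simps)
qed

text \<open>Each exponential is replaced by its Taylor polynomial at \<open>a\<close>. The error
  depends on the frequencies and the window only through \<open>N * D\<close>.\<close>

lemma exp_sum_poly_approx:
  fixes b :: "int \<Rightarrow> complex"
  assumes F: "finite F" "\<And>k. k \<in> F \<Longrightarrow> \<bar>real_of_int k\<bar> \<le> N" and S: "(\<Sum>k\<in>F. cmod (b k)) \<le> S"
    and ND: "0 \<le> N * D"
  obtains q where "degree q \<le> n"
    "\<And>x. \<bar>x - a\<bar> \<le> D \<Longrightarrow>
      cmod ((\<Sum>k\<in>F. b k * exp (\<i> * of_real (of_int k * x))) - poly q (of_real x))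
        \<le> S * (exp (N * D) * (N * D) ^ Suc n / fact n)"
proof
  define q where "q = (\<Sum>k\<in>F. smult (b k * exp (\<i> * of_real (of_int k * a)))
    (\<Sum>m\<le>n. smult ((\<i> * of_int k) ^ m / fact m) ([:- of_real a, 1:] ^ m)))"
  show "degree q \<le> n"
    unfolding q_def
  proof (intro degree_sum_le F order_trans[OF degree_smult_le])
    fix m assume "m \<in> {..n}"
    then show "degree ([:- complex_of_real a, 1:] ^ m) \<le> n"
      using degree_power_le[of "[:- complex_of_real a, 1:]" m] by simp
  qed auto
  fix x :: real
  assume x: "\<bar>x - a\<bar> \<le> D"
  define T where "T k = (\<Sum>m\<le>n. (\<i> * of_real (of_int k * (x - a))) ^ m / fact m)" for k :: int
  have "poly q (of_real x) = (\<Sum>k\<in>F. b k * exp (\<i> * of_real (of_int k * a)) * T k)"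
    by (simp add: q_def poly_sum T_def power_mult_distrib mult.assoc flip: of_real_diff)
  then have "(\<Sum>k\<in>F. b k * exp (\<i> * of_real (of_int k * x))) - poly q (of_real x)
      = (\<Sum>k\<in>F. b k * exp (\<i> * of_real (of_int k * a)) *
          (exp (\<i> * of_real (of_int k * (x - a))) - T k))"
    by (simp add: algebra_simps sum_subtractf flip: exp_add)
  also have "cmod \<dots> \<le> (\<Sum>k\<in>F. cmod (b k) * (exp (N * D) * (N * D) ^ Suc n / fact n))"
  proof (rule order_trans[OF norm_sum], intro sum_mono)
    fix k assume k: "k \<in> F"
    let ?z = "\<i> * complex_of_real (of_int k * (x - a))"
    have z: "cmod ?z \<le> N * D"
      using F(2)[OF k] x by (simp add: norm_mult abs_mult mult_mono del: of_real_mult)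
    have "cmod (exp ?z - T k) \<le> exp (cmod ?z) * cmod ?z ^ Suc n / fact n"
      unfolding T_def by (rule Taylor_exp_field)
    also have "\<dots> \<le> exp (N * D) * (N * D) ^ Suc n / fact n"
      using z by (intro divide_right_mono mult_mono power_mono) auto
    finally have "cmod (exp ?z - T k) \<le> exp (N * D) * (N * D) ^ Suc n / fact n" .
    from mult_left_mono[OF this norm_ge_zero[of "b k"]]
    show "cmod (b k * exp (\<i> * of_real (of_int k * a)) * (exp ?z - T k))
        \<le> cmod (b k) * (exp (N * D) * (N * D) ^ Suc n / fact n)"
      by (simp add: norm_mult del: of_real_mult)
  qed
  also have "\<dots> \<le> S * (exp (N * D) * (N * D) ^ Suc n / fact n)"
    unfolding sum_distrib_right[symmetric] using ND by (intro mult_right_mono S) auto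
  finally show "cmod ((\<Sum>k\<in>F. b k * exp (\<i> * of_real (of_int k * x))) - poly q (of_real x))
        \<le> S * (exp (N * D) * (N * D) ^ Suc n / fact n)" .
qed

text \<open>A Remez-type inequality. \<open>G\<close> contains \<open>p\<close> nodes with gaps
  \<open>\<eta> * D / p\<close>, so interpolating a Taylor polynomial of degree \<open>p - 1\<close>
  amplifies by at most \<open>(2 e / \<eta>) ^ p \<le> exp (K p)\<close>. The window is short enough
  for the Taylor error to survive this amplification.\<close>

lemma exp_sum_remez:
  fixes b :: "int \<Rightarrow> complex" and p K :: nat
  assumes F: "finite F" "\<And>k. k \<in> F \<Longrightarrow> \<bar>real_of_int k\<bar> \<le> N" and S: "(\<Sum>k\<in>F. cmod (b k)) \<le> S"
    and \<eta>: "0 < \<eta>" "\<eta> \<le> 1" "2 * exp 1 / \<eta> \<le> exp (real K)"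
    and D: "0 < D" "N * D \<le> real p / exp (real K + 4)" and p: "p > 0" and N: "N \<ge> 0"
    and G: "G \<in> sets lebesgue" "\<eta> * D \<le> measure lebesgue (G \<inter> {a..a + D})"
    and \<epsilon>: "\<And>y. y \<in> G \<Longrightarrow> cmod (\<Sum>k\<in>F. b k * exp (\<i> * of_real (of_int k * y))) \<le> \<epsilon>"
    and x: "x \<in> {a..a + D}"
  shows "cmod (\<Sum>k\<in>F. b k * exp (\<i> * of_real (of_int k * x)))
    \<le> \<epsilon> * exp (real K * real p) + 2 * S * exp (- real p)"
proof -
  let ?P = "\<lambda>x. \<Sum>k\<in>F. b k * exp (\<i> * of_real (of_int k * x))"
  obtain n where n: "p = Suc n" using p by (cases p) auto
  define R where "R = S * (exp (N * D) * (N * D) ^ Suc n / fact n)"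
  have S0: "S \<ge> 0" using S sum_nonneg[of F "\<lambda>k. cmod (b k)"] by auto
  obtain q where q: "degree q \<le> n" "\<And>x. \<bar>x - a\<bar> \<le> D \<Longrightarrow> cmod (?P x - poly q (of_real x)) \<le> R"
    unfolding R_def by (rule exp_sum_poly_approx[OF F S]) (use N D in auto)
  define g where "g = \<eta> * D / p"
  have g: "g > 0" using \<eta> D p by (simp add: g_def)
  have pg: "real p * g = \<eta> * D" using p by (simp add: g_def)
  have "real n * g < \<eta> * D" using pg g n by (simp add: algebra_simps)
  moreover have "G \<inter> {a..a + D} \<in> lmeasurable"
    using fmeasurable_Int_fmeasurable[of "{a..a + D}" lebesgue G] G by (simp add: Int_commute)
  ultimately obtain t where t: "\<And>i. i \<le> n \<Longrightarrow> t i \<in> G \<inter> {a..a + D}" "\<forall>i<n. t i + g \<le> t (Suc i)"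
    using spaced_points[of "G \<inter> {a..a + D}" g n] G(2) g
    by (metis bounded_Int bounded_closed_interval order_less_le_trans)
  have near: "cmod (?P y - poly q (of_real y)) \<le> R" if "y \<in> {a..a + D}" for y
    using that by (intro q) auto
  have node: "cmod (poly q (of_real (t i))) \<le> \<epsilon> + R" if "i \<le> n" for i
    using near[of "t i"] \<epsilon>[of "t i"] t(1)[OF that]
      norm_triangle_ineq4[of "?P (t i)" "?P (t i) - poly q (of_real (t i))"] by auto
  have "cmod (poly q (of_real x)) \<le> (\<epsilon> + R) * (2 * D / g) ^ n / fact n"
    using t node by (intro poly_bound_spaced[OF t(2) g _ x q(1)]) auto
  also have "\<dots> \<le> (\<epsilon> + R) * exp (real K * real p)"
  proof -
    have "\<epsilon> + R \<ge> 0" using node[of 0] norm_ge_zero order_trans by blast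
    have "(2 * D / g) ^ n / fact n = (2 / \<eta>) ^ n * (real p ^ p / fact p)"
      using D \<eta> by (simp add: g_def n power_mult_distrib power_divide field_simps del: of_nat_Suc)
    also have "\<dots> \<le> (2 / \<eta>) ^ p * exp (real p)"
    proof (intro mult_mono)
      show "real p ^ p / fact p \<le> exp (real p)"
        using power_le_exp_fact[of p] by (simp add: divide_le_eq)
      show "(2 / \<eta>) ^ n \<le> (2 / \<eta>) ^ p"
        using \<eta> by (intro power_increasing) (auto simp: n field_simps)
    qed (use \<eta> in auto)
    also have "\<dots> = (2 * exp 1 / \<eta>) ^ p"
      by (simp add: power_mult_distrib power_divide flip: exp_of_nat_mult)
    also have "\<dots> \<le> exp (real K) ^ p"
      using \<eta> by (intro power_mono) auto
    also have "\<dots> = exp (real K * real p)"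
      by (simp add: mult.commute flip: exp_of_nat_mult)
    finally show ?thesis
      using \<open>\<epsilon> + R \<ge> 0\<close> by (simp flip: times_divide_eq_right add: mult_left_mono)
  qed
  finally have q_le: "cmod (poly q (of_real x)) \<le> (\<epsilon> + R) * exp (real K * real p)" .
  \<comment> \<open>Origin of the 4 in \<open>exp (real K + 4)\<close>: three factors
    \<open>exp (real p)\<close> pay for \<open>exp (N * D)\<close>, for
    \<open>p ^ p / fact p\<close> and for a stray factor \<open>p\<close>. Of the remaining
    \<open>exp (- (K + 1) p)\<close>, the part \<open>exp (- K p)\<close> offsets the interpolation
    constant and \<open>exp (- p)\<close> is left.\<close>
  have "R \<le> S * exp (- (real K + 1) * real p)"
  proof -
    have ND: "N * D \<le> p * exp (- (real K + 4))" "0 \<le> N * D"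
      using D N by (simp_all only: exp_minus divide_inverse) (simp add: mult_nonneg_nonneg)
    have "exp (- (real K + 4)) \<le> exp 0" by (subst exp_le_cancel_iff) simp
    then have "p * exp (- (real K + 4)) \<le> real p * 1" by (intro mult_left_mono) auto
    with ND have e1: "exp (N * D) \<le> exp (real p)" by simp
    have "(N * D) ^ p \<le> (p * exp (- (real K + 4))) ^ p"
      using ND by (intro power_mono)
    also have "\<dots> = real p ^ p * exp (- (real K + 4) * real p)"
      by (simp add: power_mult_distrib mult.commute flip: exp_of_nat_mult)
    also have "\<dots> \<le> exp (real p) * fact p * exp (- (real K + 4) * real p)"
      by (intro mult_right_mono power_le_exp_fact) auto
    finally have "exp (N * D) * (N * D) ^ p / fact n
        \<le> exp (real p) * (exp (real p) * fact p * exp (- (real K + 4) * real p)) / fact n"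
      using e1 by (intro divide_right_mono mult_mono) (use ND in auto)
    also have "\<dots> = real p * (exp (real p) * exp (real p) * exp (- (real K + 4) * real p))"
      by (simp add: n field_simps)
    also have "\<dots> \<le> exp (real p) * (exp (real p) * exp (real p) * exp (- (real K + 4) * real p))"
      using order_trans[OF _ exp_ge_add_one_self[of "real p"], of "real p"] by (intro mult_right_mono) auto
    also have "\<dots> = exp (- (real K + 1) * real p)"
      by (simp add: algebra_simps flip: exp_add)
    finally show ?thesis
      unfolding R_def n using S0 by (intro mult_left_mono) auto
  qed
  then have R1: "R * exp (real K * real p) \<le> S * exp (- real p)"
    and R2: "R \<le> S * exp (- real p)"
  proof -
    assume R: "R \<le> S * exp (- (real K + 1) * real p)"
    then have "R * exp (real K * real p) \<le> S * exp (- (real K + 1) * real p) * exp (real K * real p)"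
      by (intro mult_right_mono) auto
    also have "\<dots> = S * exp (- real p)"
      by (simp add: algebra_simps flip: exp_add)
    finally show "R * exp (real K * real p) \<le> S * exp (- real p)" .
    have "S * exp (- (real K + 1) * real p) \<le> S * exp (- real p)"
      using S0 by (intro mult_left_mono) (auto simp: algebra_simps)
    with R show "R \<le> S * exp (- real p)" by linarith
  qed
  have "cmod (?P x) \<le> cmod (?P x - poly q (of_real x)) + cmod (poly q (of_real x))"
    using norm_triangle_ineq[of "?P x - poly q (of_real x)" "poly q (of_real x)"] by simp
  also have "\<dots> \<le> R + (\<epsilon> + R) * exp (real K * real p)"
    using near[OF x] q_le by linarith
  finally show ?thesis using R1 R2 by (simp add: algebra_simps)
qed

text \<open>A set with density zero at all of its points is negligible, so some point keeps a fixed
  proportion at every small scale. Capping \<open>\<eta>\<close> at 1/2 lets the same constant serve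
  for windows of which an interval fills half.\<close>

lemma positive_lower_density_point:
  fixes E :: "real set"
  assumes "E \<in> sets lebesgue" "\<not> negligible E"
  obtains x \<eta> h where "0 < \<eta>" "\<eta> \<le> 1/2" "0 < h"
    "\<And>d. 0 < d \<Longrightarrow> d \<le> h \<Longrightarrow> \<eta> * (2 * d) \<le> measure lebesgue (E \<inter> {x - d..x + d})"
proof -
  obtain x r e where r: "r > 0" "e > 0" and
    *: "\<And>d U. \<lbrakk>0 < d; d \<le> r; E \<inter> ball x d \<subseteq> U; U \<in> lmeasurable\<rbrakk> \<Longrightarrow>
      e * measure lebesgue (ball x d) \<le> measure lebesgue U"
    using assms(2) unfolding negligible_eq_zero_density by (metis not_less)
  show thesis
  proof (rule that[of "min e (1/2)" r x])
    fix d :: real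
    assume d: "0 < d" "d \<le> r"
    have "E \<inter> {x - d..x + d} \<in> lmeasurable"
      using fmeasurable_Int_fmeasurable[of "{x - d..x + d}" lebesgue E] assms(1) by (simp add: Int_commute)
    moreover have "ball x d = {x - d<..<x + d}" by (auto simp: dist_real_def)
    ultimately have "e * (2 * d) \<le> measure lebesgue (E \<inter> {x - d..x + d})"
      using *[OF d, of "E \<inter> {x - d..x + d}"] d by (auto simp: subset_iff)
    moreover have "min e (1/2) * (2 * d) \<le> e * (2 * d)" using d by (intro mult_right_mono) auto
    ultimately show "min e (1/2) * (2 * d) \<le> measure lebesgue (E \<inter> {x - d..x + d})" by linarith
  qed (use r in auto)
qed

section \<open>Averages of exponential sums over intervals\<close>

definition sinc :: "real \<Rightarrow> real" where
  "sinc x = (if x = 0 then 1 else sin x / x)"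

lemma has_integral_exp_symmetric:
  assumes "0 < a"
  shows "((\<lambda>t. exp (\<i> * of_real (\<nu> * t))) has_integral of_real (2 * a * sinc (a * \<nu>))) {-a..a}"
proof (cases "\<nu> = 0")
  case True
  then show ?thesis using assms has_integral_const_real[of "1 :: complex" "-a" a]
    by (simp add: sinc_def scaleR_conv_of_real)
next
  case False
  let ?F = "\<lambda>t. exp (\<i> * of_real (\<nu> * t)) / (\<i> * of_real \<nu>)"
  have "((\<lambda>t. exp (\<i> * of_real (\<nu> * t))) has_integral ?F a - ?F (-a)) {-a..a}"
  proof (rule fundamental_theorem_of_calculus)
    fix t assume "t \<in> {-a..a}"
    have "((\<lambda>z. exp (\<i> * (of_real \<nu> * z)) / (\<i> * of_real \<nu>)) has_field_derivative
        exp (\<i> * (of_real \<nu> * of_real t))) (at (of_real t))"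
      using False by (auto intro!: derivative_eq_intros simp: field_simps)
    from has_vector_derivative_real_field[OF this]
    show "(?F has_vector_derivative exp (\<i> * of_real (\<nu> * t))) (at t within {-a..a})"
      by (simp add: has_vector_derivative_at_within)
  qed (use assms in auto)
  also have "?F a - ?F (-a) = of_real (2 * a * sinc (a * \<nu>))"
    using False assms
    by (simp add: sinc_def complex_eq_iff field_simps Re_exp Im_exp Re_divide Im_divide power2_eq_square)
  finally show ?thesis .
qed

text \<open>Averaging over translates by \<open>t\<close> in \<open>{-a..a}\<close> multiplies the
  term of frequency \<open>\<nu> i\<close> by \<open>sinc (a * \<nu> i)\<close>, and an average
  obeys the same bound. It serves both to extract coefficients and to build the kernel.\<close>

lemma exp_sum_average:
  fixes c :: "'i \<Rightarrow> complex" and \<nu> :: "'i \<Rightarrow> real"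
  assumes "finite I" "0 < a"
    and bound: "\<And>t. t \<in> {-a..a} \<Longrightarrow> cmod (\<Sum>i\<in>I. c i * exp (\<i> * of_real (\<nu> i * (\<theta> + t)))) \<le> B"
  shows "cmod (\<Sum>i\<in>I. c i * of_real (sinc (a * \<nu> i)) * exp (\<i> * of_real (\<nu> i * \<theta>))) \<le> B"
proof -
  let ?s = "\<Sum>i\<in>I. c i * of_real (sinc (a * \<nu> i)) * exp (\<i> * of_real (\<nu> i * \<theta>))"
  let ?e = "\<lambda>i. exp (\<i> * of_real (\<nu> i * \<theta>))"
  have split: "c i * ?e i * exp (\<i> * of_real (\<nu> i * t)) = c i * exp (\<i> * of_real (\<nu> i * (\<theta> + t)))" for i t
    by (simp add: distrib_left exp_add)
  have "((\<lambda>t. \<Sum>i\<in>I. c i * ?e i * exp (\<i> * of_real (\<nu> i * t))) has_integral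
      (\<Sum>i\<in>I. c i * ?e i * of_real (2 * a * sinc (a * \<nu> i)))) {-a..a}"
    by (intro has_integral_sum has_integral_mult_right has_integral_exp_symmetric assms)
  also have "(\<Sum>i\<in>I. c i * ?e i * of_real (2 * a * sinc (a * \<nu> i))) = of_real (2 * a) * ?s"
    by (simp add: sum_distrib_left mult_ac)
  finally have int: "((\<lambda>t. \<Sum>i\<in>I. c i * exp (\<i> * of_real (\<nu> i * (\<theta> + t)))) has_integral
      of_real (2 * a) * ?s) {-a..a}"
    unfolding split .
  have "B \<ge> 0" using order_trans[OF norm_ge_zero bound[of 0]] \<open>0 < a\<close> by simp
  have "cmod (of_real (2 * a) * ?s) \<le> B * measure lborel {-a..a}"
    by (rule has_integral_bound_real[OF \<open>B \<ge> 0\<close> finite.emptyI int]) (use bound in auto)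
  then show ?thesis using \<open>0 < a\<close> by (simp add: norm_mult)
qed

text \<open>After shifting the frequencies by \<open>m\<close>, the average over a full period keeps
  only the term \<open>m\<close>, because \<open>sinc\<close> vanishes at nonzero multiples of
  \<open>pi\<close>.\<close>

lemma exp_sum_coeff_le:
  fixes b :: "int \<Rightarrow> complex"
  assumes F: "finite F" "m \<in> F"
    and bound: "\<And>x. cmod (\<Sum>k\<in>F. b k * exp (\<i> * of_real (of_int k * x))) \<le> B"
  shows "cmod (b m) \<le> B"
proof -
  have "cmod (\<Sum>k\<in>F. b k * of_real (sinc (pi * of_int (k - m))) * exp (\<i> * of_real (of_int (k - m) * 0))) \<le> B"
  proof (rule exp_sum_average[OF F(1) pi_gt_zero])
    fix t :: real
    have "(\<Sum>k\<in>F. b k * exp (\<i> * of_real (of_int (k - m) * (0 + t))))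
        = exp (- \<i> * of_real (of_int m * t)) * (\<Sum>k\<in>F. b k * exp (\<i> * of_real (of_int k * t)))"
      by (simp add: sum_distrib_left algebra_simps flip: exp_add)
    also have "cmod \<dots> = cmod (\<Sum>k\<in>F. b k * exp (\<i> * of_real (of_int k * t)))"
      by (simp add: norm_mult)
    finally show "cmod (\<Sum>k\<in>F. b k * exp (\<i> * of_real (of_int (k - m) * (0 + t)))) \<le> B"
      using bound[of t] by simp
  qed
  moreover have "sinc (pi * of_int (k - m)) = (if k = m then 1 else 0)" for k
    using sin_npi_int[of "k - m"] by (auto simp: sinc_def mult.commute)
  then have "(\<Sum>k\<in>F. b k * of_real (sinc (pi * of_int (k - m))) * exp (\<i> * of_real (of_int (k - m) * 0))) =
      (\<Sum>k\<in>F. if k = m then b k else 0)"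
    by (intro sum.cong) (auto simp del: of_int_diff)
  ultimately show ?thesis using F by simp
qed

section \<open>Scales extracted from the divergent series\<close>

text \<open>Term by term comparison with the telescoping differences
  \<open>2 / k - 2 / (k + 1)\<close>.\<close>

lemma sum_inverse_square_le:
  assumes "0 < a" "a \<le> b"
  shows "(\<Sum>k=a..<b. 1 / (1 + (real k)\<^sup>2)) \<le> 2 / real a - 2 / real b"
  using assms(2)
proof (induction b rule: dec_induct)
  case (step b)
  have "1 / (1 + (real b)\<^sup>2) \<le> 2 / real b - 2 / real (Suc b)"
  proof -
    have "b > 0" using step assms by simp
    then have "2 / real b - 2 / real (Suc b) = 2 / (real b * (real b + 1))" by (simp add: field_simps)
    moreover have "real b * (real b + 1) \<le> 2 * (1 + (real b)\<^sup>2)"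
      using zero_le_power2[of "real b - 1/2"] by (simp add: power2_eq_square algebra_simps)
    then have "1 / (1 + (real b)\<^sup>2) \<le> 2 / (real b * (real b + 1))"
      using \<open>b > 0\<close> by (simp add: field_simps power2_eq_square add_pos_pos)
    ultimately show ?thesis by simp
  qed
  with step show ?case by simp
qed simp

text \<open>Between consecutive terms of \<open>N\<close> the function grows by a factor less than \<open>M\<close>, so
  each block of the divergent series is comparable to its first term divided by the length scale.\<close>

lemma geometric_growth_subsequence:
  fixes \<phi> :: "real \<Rightarrow> real" and M :: nat
  assumes nonneg: "\<And>x. 0 \<le> x \<Longrightarrow> 0 \<le> \<phi> x"
    and inc: "mono_on {0..} \<phi>"
    and unbounded: "filterlim \<phi> at_top at_top"
    and div: "\<not> summable (\<lambda>k. \<phi> (real k) / (1 + (real k)\<^sup>2))"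
    and M: "M \<ge> 2"
  obtains N p :: "nat \<Rightarrow> nat" where
    "\<And>j. 0 < N j" "strict_mono N" "\<And>j. 0 < p j" "\<And>j. real (M * p j) \<le> \<phi> (real (N j))"
    "\<And>j. M * p j \<le> p (Suc j)" "\<not> summable (\<lambda>j. real (p j) / real (N j))"
proof -
  \<comment> \<open>Rounded down because \<open>p j\<close> will be a number of interpolation nodes;
    dividing by \<open>M\<close> first leaves the room
    \<open>M * p j \<le> \<phi> (N j)\<close>.\<close>
  define q where "q n = nat \<lfloor>\<phi> (real n) / real M\<rfloor>" for n
  have q_le: "real (M * q n) \<le> \<phi> (real n)" for n
  proof -
    have "real (q n) \<le> \<phi> (real n) / real M"
      unfolding q_def using nonneg[of n] M by (simp add: of_nat_nat)
    then show ?thesis using M by (simp add: field_simps)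
  qed
  have q_gt: "\<phi> (real n) < real M * (real (q n) + 1)" for n
  proof -
    have "\<phi> (real n) / real M < real (q n) + 1"
      unfolding q_def using nonneg[of n] M by (simp add: of_nat_nat)
    then show ?thesis using M by (simp add: field_simps)
  qed
  have q_mono: "q m \<le> q n" if "m \<le> n" for m n
    unfolding q_def using mono_onD[OF inc, of "real m" "real n"] that M
    by (intro nat_mono floor_mono divide_right_mono) auto
  have q_large: "\<exists>n>0. B \<le> q n" for B
  proof -
    have "\<forall>\<^sub>F n in sequentially. real M * (real B + 1) \<le> \<phi> (real n)"
      using filterlim_compose[OF unbounded filterlim_real_sequentially]
      by (auto simp: filterlim_at_top)
    then obtain n0 where n0: "\<And>n. n \<ge> n0 \<Longrightarrow> real M * (real B + 1) \<le> \<phi> (real n)"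
      by (auto simp: eventually_sequentially)
    have "real M * (real B + 1) < real M * (real (q (Suc n0)) + 1)"
      using n0[of "Suc n0"] q_gt[of "Suc n0"] by linarith
    then have "B \<le> q (Suc n0)" using M by simp
    then show ?thesis by blast
  qed
  define nxt where "nxt n = (LEAST m. M * q n \<le> q m)" for n
  have nxt_ge: "M * q n \<le> q (nxt n)" for n
    unfolding nxt_def using q_large[of "M * q n"] by (metis (mono_tags, lifting) LeastI)
  have nxt_least: "q m < M * q n" if "m < nxt n" for m n
    using not_less_Least[OF that[unfolded nxt_def]] by simp
  obtain n0 where n0: "n0 > 0" "1 \<le> q n0" using q_large by blast
  define N where "N j = (nxt ^^ j) n0" for j
  have N_Suc: "N (Suc j) = nxt (N j)" for j by (simp add: N_def)
  have qpos: "0 < q (N j)" for j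
  proof (induction j)
    case (Suc j)
    then show ?case using nxt_ge[of "N j"] M by (metis N_Suc mult_pos_pos less_le_trans pos2)
  qed (use n0 in \<open>simp add: N_def\<close>)
  have "N j < N (Suc j)" for j
  proof (rule ccontr)
    assume "\<not> N j < N (Suc j)"
    then have "q (N (Suc j)) \<le> q (N j)" using q_mono by simp
    moreover have "2 * q (N j) \<le> M * q (N j)" using M by simp
    ultimately show False using nxt_ge[of "N j"] qpos[of j] unfolding N_Suc by linarith
  qed
  then have step: "N j < N (Suc j)" for j .
  then have smono: "strict_mono N" by (simp add: strict_mono_Suc_iff)
  have Npos: "0 < N j" for j
  proof -
    have "N 0 \<le> N j" by (simp add: strict_mono_less_eq[OF smono])
    moreover have "N 0 = n0" by (simp add: N_def)
    ultimately show ?thesis using n0 by simp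
  qed
  have "\<not> summable (\<lambda>j. real (q (N j)) / real (N j))"
  proof
    let ?r = "\<lambda>j. real (q (N j)) / real (N j)"
    let ?g = "\<lambda>k. \<phi> (real k) / (1 + (real k)\<^sup>2)"
    assume summ: "summable ?r"
    have block: "(\<Sum>k=N j..<N (Suc j). ?g k) \<le> 2 * (real M)\<^sup>2 * ?r j" for j
    proof -
      have "(\<Sum>k=N j..<N (Suc j). ?g k) \<le>
          (\<Sum>k=N j..<N (Suc j). (real M)\<^sup>2 * real (q (N j)) * (1 / (1 + (real k)\<^sup>2)))"
      proof (rule sum_mono)
        fix k assume "k \<in> {N j..<N (Suc j)}"
        \<comment> \<open>Minimality of \<open>nxt\<close> gives \<open>q k < M * q (N j)\<close>;
          strictness between natural numbers absorbs the rounding in \<open>q_gt\<close>.\<close>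
        then have "q k + 1 \<le> M * q (N j)" using nxt_least[of k "N j"] N_Suc by simp
        then have "real (q k) + 1 \<le> real M * real (q (N j))"
          by (metis of_nat_1 of_nat_add of_nat_le_iff of_nat_mult)
        then have "real M * (real (q k) + 1) \<le> real M * (real M * real (q (N j)))"
          by (intro mult_left_mono) auto
        with q_gt[of k] have "\<phi> (real k) \<le> (real M)\<^sup>2 * real (q (N j))"
          by (simp add: power2_eq_square)
        then show "?g k \<le> (real M)\<^sup>2 * real (q (N j)) * (1 / (1 + (real k)\<^sup>2))"
          by (simp add: divide_right_mono)
      qed
      also have "\<dots> \<le> (real M)\<^sup>2 * real (q (N j)) * (2 / real (N j))"
        unfolding sum_distrib_left[symmetric]
        using sum_inverse_square_le[OF Npos[of j], of "N (Suc j)"] step[of j]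
        by (intro mult_left_mono) (auto intro: order_trans)
      finally show ?thesis by (simp add: mult_ac)
    qed
    have gnn: "0 \<le> ?g k" for k using nonneg[of k] by (simp add: add_pos_nonneg)
    have "(\<Sum>k<N J. ?g k) \<le> (\<Sum>k<N 0. ?g k) + 2 * (real M)\<^sup>2 * (\<Sum>j<J. ?r j)" for J
    proof (induction J)
      case (Suc J)
      have split: "{..<N (Suc J)} = {..<N J} \<union> {N J..<N (Suc J)}" using step[of J] by auto
      have "(\<Sum>k<N (Suc J). ?g k) = (\<Sum>k<N J. ?g k) + (\<Sum>k=N J..<N (Suc J). ?g k)"
        unfolding split by (rule sum.union_disjoint) auto
      with Suc block[of J] show ?case by (simp add: algebra_simps)
    qed simp
    moreover have "(\<Sum>j<J. ?r j) \<le> suminf ?r" for J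
      using summ by (intro sum_le_suminf) auto
    ultimately have bd: "(\<Sum>k<N J. ?g k) \<le> (\<Sum>k<N 0. ?g k) + 2 * (real M)\<^sup>2 * suminf ?r" for J
      by (meson add_left_mono mult_left_mono order_trans zero_le_mult_iff zero_le_numeral zero_le_power2)
    have "summable ?g"
    proof (rule summableI_nonneg_bounded[of _ "(\<Sum>k<N 0. ?g k) + 2 * (real M)\<^sup>2 * suminf ?r"])
      fix n
      have "(\<Sum>k<n. ?g k) \<le> (\<Sum>k<N n. ?g k)"
        using strict_mono_imp_increasing[OF smono, of n] gnn by (intro sum_mono2) auto
      with bd[of n] show "(\<Sum>k<n. ?g k) \<le> (\<Sum>k<N 0. ?g k) + 2 * (real M)\<^sup>2 * suminf ?r" by linarith
    qed (rule gnn)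
    with div show False by contradiction
  qed
  then show thesis
    using that[of N "\<lambda>j. q (N j)"] Npos smono qpos q_le nxt_ge N_Suc by simp
qed


section \<open>Uniqueness for weighted Fourier series\<close>

definition partial_exp_sum :: "(int \<Rightarrow> complex) \<Rightarrow> nat \<Rightarrow> real \<Rightarrow> complex" where
  "partial_exp_sum b N x = (\<Sum>k\<in>{- int N..int N}. b k * exp (\<i> * of_real (of_int k * x)))"

locale weighted_exp_series =
  fixes b :: "int \<Rightarrow> complex" and \<psi> :: "real \<Rightarrow> real" and S :: real
  assumes nonneg: "\<And>x. 0 \<le> x \<Longrightarrow> 0 \<le> \<psi> x"
    and inc: "mono_on {0..} \<psi>"
    and weighted: "\<And>A. finite A \<Longrightarrow> (\<Sum>k\<in>A. cmod (b k) * exp (\<psi> \<bar>real_of_int k\<bar>)) \<le> S"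
begin

lemma S_nonneg: "0 \<le> S"
  using weighted[of "{}"] by simp

lemma sum_coeff_le:
  assumes "finite A"
  shows "(\<Sum>k\<in>A. cmod (b k)) \<le> S"
proof -
  have "(\<Sum>k\<in>A. cmod (b k)) \<le> (\<Sum>k\<in>A. cmod (b k) * exp (\<psi> \<bar>real_of_int k\<bar>))"
    by (intro sum_mono) (auto simp: mult_le_cancel_left1 nonneg)
  then show ?thesis using weighted[OF assms] by linarith
qed

lemma tail_le:
  assumes "finite A" "\<And>k. k \<in> A \<Longrightarrow> real N \<le> \<bar>real_of_int k\<bar>"
  shows "(\<Sum>k\<in>A. cmod (b k)) \<le> S * exp (- \<psi> (real N))"
proof -
  have "(\<Sum>k\<in>A. cmod (b k)) * exp (\<psi> (real N)) \<le> (\<Sum>k\<in>A. cmod (b k) * exp (\<psi> \<bar>real_of_int k\<bar>))"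
    unfolding sum_distrib_right using assms mono_onD[OF inc]
    by (intro sum_mono mult_left_mono) auto
  also have "\<dots> \<le> S" using weighted[OF assms(1)] .
  finally show ?thesis by (simp add: exp_minus field_simps)
qed

lemma norm_partial_diff_le:
  assumes "finite F" "{- int N..int N} \<subseteq> F"
  shows "cmod ((\<Sum>k\<in>F. b k * exp (\<i> * of_real (of_int k * x))) - partial_exp_sum b N x)
    \<le> S * exp (- \<psi> (real N))"
proof -
  have "(\<Sum>k\<in>F. b k * exp (\<i> * of_real (of_int k * x))) - partial_exp_sum b N x
      = (\<Sum>k\<in>F - {- int N..int N}. b k * exp (\<i> * of_real (of_int k * x)))"
    unfolding partial_exp_sum_def using assms by (simp add: sum_diff)
  also have "cmod \<dots> \<le> (\<Sum>k\<in>F - {- int N..int N}. cmod (b k))"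
    by (rule order_trans[OF norm_sum]) (simp add: norm_mult)
  also have "\<dots> \<le> S * exp (- \<psi> (real N))"
    using assms(1) by (intro tail_le) auto
  finally show ?thesis .
qed

text \<open>Where the series vanishes, the partial sum is minus the tail.\<close>

lemma partial_le_at_zero:
  assumes "((\<lambda>k. b k * exp (\<i> * of_real (of_int k * x))) has_sum 0) UNIV"
  shows "cmod (partial_exp_sum b N x) \<le> S * exp (- \<psi> (real N))"
proof -
  have "((\<lambda>F. cmod ((\<Sum>k\<in>F. b k * exp (\<i> * of_real (of_int k * x))) - partial_exp_sum b N x))
      \<longlongrightarrow> cmod (0 - partial_exp_sum b N x)) (finite_subsets_at_top UNIV)"
    using assms unfolding has_sum_def by (intro tendsto_intros)
  then have "cmod (0 - partial_exp_sum b N x) \<le> S * exp (- \<psi> (real N))"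
  proof (rule tendsto_upperbound)
    show "\<forall>\<^sub>F F in finite_subsets_at_top UNIV.
        cmod ((\<Sum>k\<in>F. b k * exp (\<i> * of_real (of_int k * x))) - partial_exp_sum b N x)
        \<le> S * exp (- \<psi> (real N))"
      unfolding eventually_finite_subsets_at_top
      by (rule exI[of _ "{- int N..int N}"]) (use norm_partial_diff_le in auto)
  qed simp
  then show ?thesis by simp
qed

text \<open>One spreading step. The input \<open>6 * S\<close> will be \<open>5 * S\<close> from the
  next larger scale plus \<open>S\<close> for the change of partial sum. In the output
  \<open>5 * S\<close>, the part \<open>3 * S\<close> is the amplified input
  (\<open>exp (- (K + 2) p)\<close> times \<open>exp (K p)\<close> leaves two factors
  \<open>exp (- p)\<close>, one of them at most 1/2) and \<open>2 * S\<close> is the Taylor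
  error.\<close>

lemma partial_small_extend:
  fixes p K N :: nat
  assumes \<eta>: "0 < \<eta>" "\<eta> \<le> 1/2" "2 * exp 1 / \<eta> \<le> exp (real K)"
    and D: "0 < D" "real N * D \<le> real p / exp (real K + 4)" and p: "0 < p"
    and E: "E \<in> sets lebesgue" "\<eta> * D \<le> measure lebesgue (E \<inter> {x0 - D/2..x0 + D/2})"
    and onE: "\<And>y. y \<in> E \<Longrightarrow> cmod (partial_exp_sum b N y) \<le> 6 * S * exp (- real ((K + 2) * p))"
    and onJ: "\<And>y. \<bar>y - x0\<bar> < s \<Longrightarrow> cmod (partial_exp_sum b N y) \<le> 6 * S * exp (- real ((K + 2) * p))"
    and x: "\<bar>x - x0\<bar> < s + D / 4"
  shows "cmod (partial_exp_sum b N x) \<le> 5 * S * exp (- real p)"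
proof -
  define G where "G = E \<union> {x0 - s<..<x0 + s}"
  have G: "G \<in> sets lebesgue" using E by (auto simp: G_def)
  have onG: "cmod (partial_exp_sum b N y) \<le> 6 * S * exp (- real ((K + 2) * p))" if "y \<in> G" for y
    using that onE onJ[of y] by (auto simp: G_def abs_less_iff)
  have p1: "exp (- real p) \<le> 1 / 2"
  proof -
    have "2 \<le> exp (real p)" using p exp_ge_add_one_self[of "real p"] by linarith
    then show ?thesis by (simp add: exp_minus field_simps)
  qed
  have collapse: "6 * S * exp (- real ((K + 2) * p)) * exp (real K * real p) \<le> 3 * S * exp (- real p)"
  proof -
    have "exp (- real ((K + 2) * p)) * exp (real K * real p) = exp (- real p) * exp (- real p)"
      by (simp add: algebra_simps flip: exp_add)
    also have "\<dots> \<le> exp (- real p) * (1 / 2)" using p1 by (intro mult_left_mono) auto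
    finally have "6 * S * (exp (- real ((K + 2) * p)) * exp (real K * real p)) \<le> 6 * S * (exp (- real p) * (1 / 2))"
      using S_nonneg by (intro mult_left_mono) auto
    then show ?thesis by (simp add: mult_ac)
  qed
  have main: ?thesis if a: "x \<in> {a..a + D}" "\<eta> * D \<le> measure lebesgue (G \<inter> {a..a + D})" for a
  proof -
    have "cmod (partial_exp_sum b N x)
        \<le> 6 * S * exp (- real ((K + 2) * p)) * exp (real K * real p) + 2 * S * exp (- real p)"
      unfolding partial_exp_sum_def
      using onG[unfolded partial_exp_sum_def] \<eta> D p G a
      by (intro exp_sum_remez[where N = "real N" and \<eta> = \<eta> and G = G and a = a and D = D]) (auto intro: sum_coeff_le)
    with collapse show ?thesis by linarith
  qed
  have meas: "G \<inter> {c..d} \<in> lmeasurable" for c d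
    using fmeasurable_Int_fmeasurable[of "{c..d}" lebesgue G] G by (simp add: Int_commute)
  show ?thesis
  \<comment> \<open>A short interval relies on the density of \<open>E\<close> in the window centred
    at \<open>x0\<close>. Once \<open>s > D / 4\<close>, half of a window centred at an endpoint
    lies inside the interval, and \<open>\<eta> \<le> 1/2\<close> makes that enough.\<close>
  proof (cases "s \<le> D / 4")
    case True
    have "measure lebesgue (E \<inter> {x0 - D/2..x0 + D/2}) \<le> measure lebesgue (G \<inter> {x0 - D/2..x0 + D/2})"
      using E meas by (intro measure_mono_fmeasurable) (auto simp: G_def)
    with E have "\<eta> * D \<le> measure lebesgue (G \<inter> {x0 - D/2..x0 + D/2})" by linarith
    moreover have "x0 + D/2 = (x0 - D/2) + D" by simp
    ultimately have "\<eta> * D \<le> measure lebesgue (G \<inter> {x0 - D/2..(x0 - D/2) + D})" by (simp only:)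
    then show ?thesis
      using x True by (intro main[of "x0 - D/2"]) (auto simp: abs_less_iff)
  next
    case False
    have half: "\<eta> * D \<le> measure lebesgue (G \<inter> {a..a + D})"
      if "a \<le> c" "c + D / 2 \<le> a + D" "x0 - s \<le> c" "c + D/2 \<le> x0 + s" for a c
    proof -
      have "\<eta> * D \<le> 1/2 * D" using \<eta> D by (intro mult_right_mono) auto
      also have "\<dots> = measure lebesgue {c<..<c + D / 2}" using D by simp
      also have "\<dots> \<le> measure lebesgue (G \<inter> {a..a + D})"
        using meas that by (intro measure_mono_fmeasurable) (auto simp: G_def)
      finally show ?thesis .
    qed
    consider "\<bar>x - x0\<bar> < s" | "x0 + s \<le> x" | "x \<le> x0 - s" by linarith
    then show ?thesis
    proof cases
      case 1
      have "exp (- real ((K + 2) * p)) \<le> exp (- real p) * exp (- real p)"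
        using p by (simp flip: exp_add add: algebra_simps)
      also have "\<dots> \<le> exp (- real p) * (1 / 2)" using p1 by (intro mult_left_mono) auto
      finally have "6 * S * exp (- real ((K + 2) * p)) \<le> 6 * S * (exp (- real p) * (1 / 2))"
        using S_nonneg by (intro mult_left_mono) auto
      moreover have "0 \<le> S * exp (- real p)" using S_nonneg by simp
      ultimately show ?thesis using onJ[OF 1] by simp
    next
      case 2
      with x False show ?thesis
        by (intro main[of "x0 + s - D/2"] half[of _ "x0 + s - D/2"]) (auto simp: abs_less_iff)
    next
      case 3
      with x False show ?thesis
        by (intro main[of "x0 - s - D/2"] half[of _ "x0 - s "]) (auto simp: abs_less_iff)
    qed
  qed
qed

theorem coeff_zero_of_has_sum_zero_on:
  assumes unbounded: "filterlim \<psi> at_top at_top"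
    and div: "\<not> summable (\<lambda>k. \<psi> (real k) / (1 + (real k)\<^sup>2))"
    and E: "E \<in> sets lebesgue" "\<not> negligible E"
    and zero: "\<And>x. x \<in> E \<Longrightarrow> ((\<lambda>k. b k * exp (\<i> * of_real (of_int k * x))) has_sum 0) UNIV"
  shows "b m = 0"
proof -
  obtain x0 \<eta> h where \<eta>: "0 < \<eta>" "\<eta> \<le> 1/2" and h: "0 < h"
    and dens: "\<And>d. 0 < d \<Longrightarrow> d \<le> h \<Longrightarrow> \<eta> * (2 * d) \<le> measure lebesgue (E \<inter> {x0 - d..x0 + d})"
    using positive_lower_density_point[OF E] by metis
  define K where "K = nat \<lceil>2 * exp 1 / \<eta>\<rceil>"
  have K: "2 * exp 1 / \<eta> \<le> exp (real K)"
  proof -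
    have "2 * exp 1 / \<eta> \<le> real K" unfolding K_def by linarith
    then show ?thesis using exp_ge_add_one_self[of "real K"] by linarith
  qed
  obtain N p :: "nat \<Rightarrow> nat" where N: "\<And>j. 0 < N j" "strict_mono N" and p: "\<And>j. 0 < p j"
    and p\<psi>: "\<And>j. real ((K + 2) * p j) \<le> \<psi> (real (N j))" and p_Suc: "\<And>j. (K + 2) * p j \<le> p (Suc j)"
    and nsum: "\<not> summable (\<lambda>j. real (p j) / real (N j))"
    using geometric_growth_subsequence[OF nonneg inc unbounded div, of "K + 2"] by auto
  \<comment> \<open>\<open>h\<close> keeps the window in the range where the density at
    \<open>x0\<close> is known; the other term is the length that \<open>exp_sum_remez\<close>
    allows.\<close>
  define D where "D j = min h (real (p j) / exp (real K + 4) / real (N j))" for j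
  have Dpos: "0 < D j" for j using h p N by (simp add: D_def)
  have ND: "real (N j) * D j \<le> real (p j) / exp (real K + 4)" for j
  proof -
    have "real (N j) * D j \<le> real (N j) * (real (p j) / exp (real K + 4) / real (N j))"
      unfolding D_def by (intro mult_left_mono) auto
    then show ?thesis using N(1)[of j] by simp
  qed
  have D_not_summable: "\<not> summable D"
  proof
    assume "summable D"
    then have "eventually (\<lambda>j. D j < h) sequentially"
      using h summable_LIMSEQ_zero order_tendstoD(2) by blast
    then have "eventually (\<lambda>j. D j = inverse (exp (real K + 4)) * (real (p j) / real (N j))) sequentially"
      by eventually_elim (auto simp: D_def min_def field_simps split: if_splits)
    then have "summable (\<lambda>j. inverse (exp (real K + 4)) * (real (p j) / real (N j)))"
      using \<open>summable D\<close> summable_cong by metis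
    with nsum show False by (simp only: summable_cmult_iff) simp
  qed
  have exp_p: "S * exp (- \<psi> (real (N j))) \<le> S * exp (- real ((K + 2) * p j))" for j
    using S_nonneg p\<psi>[of j] by (intro mult_left_mono) auto
  \<comment> \<open>Downward induction from \<open>J\<close>. At \<open>j = J\<close> the sum is
    empty and the claim vacuous, so no smallness off \<open>E\<close> is needed to start.\<close>
  have claim: "\<forall>x. \<bar>x - x0\<bar> < (\<Sum>i=j..<J. D i / 4) \<longrightarrow>
      cmod (partial_exp_sum b (N j) x) \<le> 5 * S * exp (- real (p j))" if "j \<le> J" for j J
    using that
  proof (induction j rule: inc_induct)
    case (step j)
    let ?s = "\<Sum>i=Suc j..<J. D i / 4"
    have D2: "\<eta> * D j \<le> measure lebesgue (E \<inter> {x0 - D j/2..x0 + D j/2})"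
      using dens[of "D j / 2"] Dpos[of j] h by (auto simp: D_def)
    have onE: "cmod (partial_exp_sum b (N j) y) \<le> 6 * S * exp (- real ((K + 2) * p j))" if "y \<in> E" for y
      using partial_le_at_zero[OF zero[OF that], of "N j"] exp_p[of j]
        mult_nonneg_nonneg[OF S_nonneg exp_ge_zero[of "- real ((K + 2) * p j)"]] by linarith
    have onJ: "cmod (partial_exp_sum b (N j) y) \<le> 6 * S * exp (- real ((K + 2) * p j))"
      if "\<bar>y - x0\<bar> < ?s" for y
    proof -
      have "N j < N (Suc j)" using N(2) by (simp add: strict_mono_less)
      then have "cmod (partial_exp_sum b (N (Suc j)) y - partial_exp_sum b (N j) y) \<le> S * exp (- \<psi> (real (N j)))"
        using norm_partial_diff_le[of "{- int (N (Suc j))..int (N (Suc j))}" "N j" y]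
        by (auto simp: partial_exp_sum_def)
      moreover have "cmod (partial_exp_sum b (N (Suc j)) y) \<le> 5 * S * exp (- real (p (Suc j)))"
        using step.IH that by blast
      moreover have "5 * S * exp (- real (p (Suc j))) \<le> 5 * S * exp (- real ((K + 2) * p j))"
        using S_nonneg p_Suc[of j] by (intro mult_left_mono) (auto simp del: of_nat_mult of_nat_add)
      ultimately show ?thesis
        using exp_p[of j] norm_triangle_sub[of "partial_exp_sum b (N j) y" "partial_exp_sum b (N (Suc j)) y"]
        by (simp add: norm_minus_commute)
    qed
    have "(\<Sum>i=j..<J. D i / 4) = ?s + D j / 4"
      using step by (simp add: sum.atLeast_Suc_lessThan)
    then show ?case
      using partial_small_extend[OF \<eta> K Dpos ND p E(1) D2 onE onJ] by simp
  qed simp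
  have small: "cmod (partial_exp_sum b (N j) x) \<le> 5 * S * exp (- real (p j))" for j x
  proof -
    \<comment> \<open>\<open>J\<close> is free, so by divergence the interval reached at the fixed
      scale \<open>j\<close> covers any given \<open>x\<close>.\<close>
    have "\<exists>J\<ge>j. \<bar>x - x0\<bar> < (\<Sum>i=j..<J. D i / 4)"
    proof (rule ccontr)
      assume "\<not> ?thesis"
      then have le: "(\<Sum>i=j..<J. D i / 4) \<le> \<bar>x - x0\<bar>" if "J \<ge> j" for J using that by (meson not_less)
      have "summable (\<lambda>i. D (i + j) / 4)"
      proof (rule summableI_nonneg_bounded)
        fix n
        have "(\<Sum>i<n. D (i + j) / 4) = (\<Sum>i=j..<n + j. D i / 4)"
          using sum.shift_bounds_nat_ivl[of "\<lambda>i. D i / 4" 0 j n] by (simp add: lessThan_atLeast0)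
        with le[of "n + j"] show "(\<Sum>i<n. D (i + j) / 4) \<le> \<bar>x - x0\<bar>" by simp
      qed (use Dpos less_imp_le in auto)
      then have "summable (\<lambda>i. D (i + j))" using summable_mult[of "\<lambda>i. D (i + j) / 4" 4] by simp
      then show False using D_not_summable by (simp add: summable_iff_shift)
    qed
    then show ?thesis using claim by blast
  qed
  \<comment> \<open>\<open>b m\<close> is a Fourier coefficient of every partial sum reaching
    \<open>m\<close>, and these are now uniformly small on the line; \<open>p j \<ge> j\<close>
    sends the bound to 0.\<close>
  have "cmod (b m) \<le> 5 * S * exp (- real j)" if "nat \<bar>m\<bar> \<le> j" for j
  proof -
    have "j \<le> N j" using strict_mono_imp_increasing[OF N(2)] .
    then have "m \<in> {- int (N j)..int (N j)}" using that by auto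
    from exp_sum_coeff_le[OF finite_atLeastAtMost_int this small[of j, unfolded partial_exp_sum_def]]
    have "cmod (b m) \<le> 5 * S * exp (- real (p j))" .
    moreover have "j \<le> p j"
    proof (induction j)
      case (Suc j)
      have "2 * p j \<le> (K + 2) * p j" by (intro mult_right_mono) auto
      with p_Suc[of j] p[of j] Suc show ?case by linarith
    qed simp
    then have "5 * S * exp (- real (p j)) \<le> 5 * S * exp (- real j)"
      using S_nonneg by (intro mult_left_mono) auto
    ultimately show ?thesis by linarith
  qed
  then have "eventually (\<lambda>j. cmod (b m) \<le> 5 * S * exp (- real j)) sequentially"
    unfolding eventually_sequentially by blast
  moreover have "(\<lambda>j. 5 * S * exp (- real j)) \<longlonglongrightarrow> 5 * S * 0"
  proof (intro tendsto_intros)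
    show "(\<lambda>j. exp (- real j)) \<longlonglongrightarrow> 0"
      by (rule filterlim_compose[OF exp_at_bot])
        (simp add: filterlim_uminus_at_bot filterlim_real_sequentially)
  qed
  ultimately have "cmod (b m) \<le> 5 * S * 0"
    using tendsto_lowerbound trivial_limit_sequentially by blast
  then show ?thesis by simp
qed

end


section \<open>Separation in weighted sequence spaces\<close>

definition sublinear :: "('a::real_vector \<Rightarrow> real) \<Rightarrow> bool" where
  "sublinear q \<longleftrightarrow> (\<forall>x y. q (x + y) \<le> q x + q y) \<and> (\<forall>c x. 0 \<le> c \<longrightarrow> q (c *\<^sub>R x) = c * q x)"

lemma sublinear_minus_le:
  assumes "sublinear q"
  shows "- q (- x) \<le> q x"
proof -
  have "q (0 *\<^sub>R x) = 0 * q x" using assms unfolding sublinear_def by blast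
  moreover have "q (x + - x) \<le> q x + q (- x)" using assms unfolding sublinear_def by blast
  ultimately show ?thesis by simp
qed

text \<open>A single criterion for three infima: over tilts of a functional, over a chain, and over
  the distances to points of a subspace. The index may change in each inequality, which is what
  directed families provide.\<close>

lemma sublinear_INF:
  fixes q :: "'i \<Rightarrow> 'a::real_vector \<Rightarrow> real"
  assumes "I \<noteq> {}" and bdd: "\<And>x. bdd_below ((\<lambda>i. q i x) ` I)"
    and add: "\<And>i j x y. i \<in> I \<Longrightarrow> j \<in> I \<Longrightarrow> \<exists>k\<in>I. q k (x + y) \<le> q i x + q j y"
    and scale: "\<And>i c x. i \<in> I \<Longrightarrow> 0 < c \<Longrightarrow> \<exists>k\<in>I. q k (c *\<^sub>R x) \<le> c * q i x"
    and zero: "\<And>i. i \<in> I \<Longrightarrow> 0 \<le> q i 0" "\<exists>i\<in>I. q i 0 \<le> 0"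
  shows "sublinear (\<lambda>x. INF i\<in>I. q i x)"
proof -
  let ?u = "\<lambda>x. INF i\<in>I. q i x"
  have lower: "?u x \<le> q i x" if "i \<in> I" for i x using bdd that by (rule cINF_lower)
  have "?u (x + y) \<le> ?u x + ?u y" for x y
  proof -
    have "?u (x + y) - q j y \<le> ?u x" if j: "j \<in> I" for j
    proof (rule cINF_greatest[OF \<open>I \<noteq> {}\<close>])
      fix i assume "i \<in> I"
      with add[OF this j, of x y] lower[of _ "x + y"] show "?u (x + y) - q j y \<le> q i x" by force
    qed
    then have "?u (x + y) - ?u x \<le> ?u y"
      by (intro cINF_greatest[OF \<open>I \<noteq> {}\<close>]) (auto simp: algebra_simps)
    then show ?thesis by simp
  qed
  moreover have le: "?u (c *\<^sub>R x) \<le> c * ?u x" if "c > 0" for c x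
  proof -
    have "?u (c *\<^sub>R x) / c \<le> ?u x"
    proof (rule cINF_greatest[OF \<open>I \<noteq> {}\<close>])
      fix i assume "i \<in> I"
      with scale[OF this that, of x] lower[of _ "c *\<^sub>R x"] have "?u (c *\<^sub>R x) \<le> c * q i x" by force
      then show "?u (c *\<^sub>R x) / c \<le> q i x" using that by (simp add: field_simps)
    qed
    then show ?thesis using that by (simp add: field_simps)
  qed
  moreover have "c * ?u x \<le> ?u (c *\<^sub>R x)" if "c > 0" for c x
    using le[of "inverse c" "c *\<^sub>R x"] that by (simp add: field_simps)
  moreover have "?u 0 = 0"
    using zero lower[of _ 0] by (intro antisym cINF_greatest[OF \<open>I \<noteq> {}\<close>]) (auto intro: order_trans)
  ultimately show ?thesis
    unfolding sublinear_def by (metis antisym less_eq_real_def mult_zero_left scale_zero_left)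
qed

text \<open>\<open>q\<close> is the infimum of \<open>p (x + t w) - t p w\<close> over
  \<open>t \<ge> 0\<close>. If \<open>p\<close> is minimal then \<open>q = p\<close>, and the second
  bound becomes the missing half of additivity.\<close>

lemma sublinear_tilt:
  assumes "sublinear p"
  obtains q where "sublinear q" "\<And>x. q x \<le> p x" "\<And>x. q x \<le> p (x + w) - p w"
proof -
  have add: "p (x + y) \<le> p x + p y" for x y using assms by (simp add: sublinear_def)
  have hom: "p (c *\<^sub>R x) = c * p x" if "0 \<le> c" for c x using assms that by (simp add: sublinear_def)
  define r where "r t x = p (x + t *\<^sub>R w) - t * p w" for t x
  have bdd: "bdd_below ((\<lambda>t. r t x) ` {0..})" for x
  proof (rule bdd_belowI2)
    fix t :: real assume "t \<in> {0..}"
    then show "- p (- x) \<le> r t x"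
      using add[of "x + t *\<^sub>R w" "- x"] hom[of t w] by (simp add: r_def)
  qed
  have "p 0 = 0" using hom[of 0 0] by simp
  have "sublinear (\<lambda>x. INF t\<in>{0..}. r t x)"
  proof (rule sublinear_INF)
    fix s t :: real and x y :: 'a assume st: "s \<in> {0..}" "t \<in> {0..}"
    have "r (s + t) (x + y) \<le> r s x + r t y"
      using add[of "x + s *\<^sub>R w" "y + t *\<^sub>R w"] by (simp add: r_def algebra_simps)
    then show "\<exists>k\<in>{0..}. r k (x + y) \<le> r s x + r t y" using st by (intro bexI[of _ "s + t"]) auto
  next
    fix t c :: real and x :: 'a assume "t \<in> {0..}" "0 < c"
    then have "r (c * t) (c *\<^sub>R x) = c * r t x"
      using hom[of c "x + t *\<^sub>R w"] by (simp add: r_def algebra_simps)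
    then show "\<exists>k\<in>{0..}. r k (c *\<^sub>R x) \<le> c * r t x"
      using \<open>t \<in> {0..}\<close> \<open>0 < c\<close> by (intro bexI[of _ "c * t"]) auto
  qed (use bdd hom \<open>p 0 = 0\<close> in \<open>auto simp: r_def intro!: bexI[of _ 0]\<close>)
  moreover have lower: "(INF t\<in>{0..}. r t x) \<le> r t x" if "t \<ge> 0" for x t
    using bdd that by (intro cINF_lower) auto
  ultimately show thesis
    using lower[of 0] lower[of 1] by (intro that) (auto simp: r_def)
qed

text \<open>Hahn-Banach: a minimal sublinear functional is linear.\<close>

lemma sublinear_dominates_linear:
  fixes p :: "'a::real_vector \<Rightarrow> real"
  assumes "sublinear p"
  obtains f where "linear f" "\<And>x. f x \<le> p x" "f v = p v"
proof -
  \<comment> \<open>Tilting at \<open>v\<close> before minimising gives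
    \<open>p' (- v) \<le> - p v\<close>, so every linear functional below \<open>p'\<close> takes
    the value \<open>p v\<close> at \<open>v\<close>.\<close>
  obtain p' where p': "sublinear p'" "\<And>x. p' x \<le> p x" "\<And>x. p' x \<le> p (x + v) - p v"
    using sublinear_tilt[OF assms] by metis
  define A where "A = {q. sublinear q \<and> (\<forall>x. q x \<le> p' x)}"
  \<comment> \<open>The order is reversed, so the maximal element from Zorn's lemma is a minimal
    functional; chains are bounded by their pointwise infimum.\<close>
  define P where "P q r \<longleftrightarrow> (\<forall>x. r x \<le> q x)" for q r :: "'a \<Rightarrow> real"
  have "\<exists>m\<in>A. \<forall>a\<in>A. P m a \<longrightarrow> a = m"
  proof (rule predicate_Zorn)
    show "partial_order_on A (relation_of P A)"
      by (rule partial_order_on_relation_ofI) (auto simp: P_def fun_eq_iff intro: order_trans antisym)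
    fix C assume C: "C \<in> Chains (relation_of P A)"
    then have CA: "C \<subseteq> A" by (rule Chains_relation_of)
    show "\<exists>u\<in>A. \<forall>a\<in>C. P a u"
    proof (cases "C = {}")
      case True
      then show ?thesis using p' by (auto simp: A_def)
    next
      case False
      have bdd: "bdd_below ((\<lambda>q. q x) ` C)" for x
      proof (rule bdd_belowI2)
        fix q assume "q \<in> C"
        then have "sublinear q" "q (- x) \<le> p' (- x)" using CA by (auto simp: A_def)
        then show "- p' (- x) \<le> q x" using sublinear_minus_le[of q x] by linarith
      qed
      have total: "P q r \<or> P r q" if "q \<in> C" "r \<in> C" for q r
        using C that unfolding Chains_def relation_of_def by blast
      have "sublinear (\<lambda>x. INF q\<in>C. q x)"
      proof (rule sublinear_INF[OF False bdd])
        fix q r x y assume qr: "q \<in> C" "r \<in> C"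
        then have sub: "q (x + y) \<le> q x + q y" "r (x + y) \<le> r x + r y"
          using CA by (auto simp: A_def sublinear_def)
        from total[OF qr] show "\<exists>k\<in>C. k (x + y) \<le> q x + r y"
        proof
          assume "P q r"
          then have "r x \<le> q x" by (simp add: P_def)
          with sub qr show ?thesis by (intro bexI[of _ r]) auto
        next
          assume "P r q"
          then have "q y \<le> r y" by (simp add: P_def)
          with sub qr show ?thesis by (intro bexI[of _ q]) auto
        qed
      next
        fix q and c :: real and x assume "q \<in> C" "0 < c"
        then show "\<exists>k\<in>C. k (c *\<^sub>R x) \<le> c * q x"
          using CA by (intro bexI[of _ q]) (auto simp: A_def sublinear_def)
      next
        have q0: "q 0 = 0" if "q \<in> C" for q
        proof -
          have "q (0 *\<^sub>R 0) = 0 * q 0" using that CA unfolding A_def sublinear_def by blast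
          then show ?thesis by simp
        qed
        show "0 \<le> q 0" if "q \<in> C" for q using q0[OF that] by simp
        show "\<exists>q\<in>C. q 0 \<le> 0" using q0 False by (metis ex_in_conv order_refl)
      qed
      moreover have lower: "(INF q\<in>C. q x) \<le> q x" if "q \<in> C" for q x
        using bdd that by (rule cINF_lower)
      moreover have "(INF q\<in>C. q x) \<le> p' x" for x
      proof -
        obtain q where q: "q \<in> C" using False by blast
        then have "q x \<le> p' x" using CA by (auto simp: A_def)
        with lower[OF q, of x] show ?thesis by linarith
      qed
      ultimately show ?thesis
        by (intro bexI[of _ "\<lambda>x. INF q\<in>C. q x"]) (auto simp: A_def P_def)
    qed
  qed
  then obtain f where fA: "f \<in> A" and max: "\<And>q. q \<in> A \<Longrightarrow> P f q \<Longrightarrow> q = f" by blast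
  then have f: "sublinear f" "\<And>x. f x \<le> p' x" by (auto simp: A_def)
  have minimal: "q = f" if "sublinear q" "\<And>x. q x \<le> f x" for q
    using that f(2) by (intro max) (auto simp: A_def P_def intro: order_trans)
  have f_add: "f (x + w) = f x + f w" for x w
  proof -
    obtain q where q: "sublinear q" "\<And>x. q x \<le> f x" "\<And>x. q x \<le> f (x + w) - f w"
      using sublinear_tilt[OF f(1)] by metis
    have "f x \<le> f (x + w) - f w" using q(3)[of x] minimal[OF q(1,2)] by simp
    moreover have "f (x + w) \<le> f x + f w" using f(1) by (simp add: sublinear_def)
    ultimately show ?thesis by linarith
  qed
  have f0: "f 0 = 0" using f_add[of 0 0] by simp
  have f_minus: "f (- x) = - f x" for x using f_add[of x "- x"] f0 by simp
  have "linear f"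
  proof (rule linearI)
    fix c :: real and x
    show "f (c *\<^sub>R x) = c *\<^sub>R f x"
    proof (cases "0 \<le> c")
      case True
      then show ?thesis using f(1) by (simp add: sublinear_def)
    next
      case False
      then have "0 \<le> - c" by simp
      then have "f ((- c) *\<^sub>R x) = (- c) * f x" using f(1) unfolding sublinear_def by blast
      then show ?thesis using f_minus[of "c *\<^sub>R x"] by simp
    qed
  qed (rule f_add)
  moreover have "f x \<le> p x" for x using f(2) p'(2) order_trans by blast
  moreover have "f v = p v"
  proof (rule antisym)
    have "p 0 = 0"
      using assms unfolding sublinear_def by (metis mult_zero_left order_refl scale_zero_left)
    then have "f (- v) \<le> - p v" using order_trans[OF f(2) p'(3)[of "- v"]] by simp
    then show "p v \<le> f v" using f_minus by simp
  qed fact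
  ultimately show thesis by (rule that)
qed

text \<open>A linear functional below this distance vanishes on \<open>W\<close> and has norm at
  most 1, as a separating functional should.\<close>

lemma sublinear_infdist:
  fixes W :: "'a::real_normed_vector set"
  assumes "subspace W"
  shows "sublinear (\<lambda>x. infdist x W)"
proof -
  have ne: "W \<noteq> {}" using subspace_0[OF assms] by auto
  have "sublinear (\<lambda>x. INF s\<in>W. dist x s)"
  proof (rule sublinear_INF[OF ne])
    fix s t x y assume "s \<in> W" "t \<in> W"
    then show "\<exists>k\<in>W. dist (x + y) k \<le> dist x s + dist y t"
      using assms by (intro bexI[of _ "s + t"]) (auto simp: subspace_add dist_triangle_add)
  next
    fix s x and c :: real assume "s \<in> W" "0 < c"
    then show "\<exists>k\<in>W. dist (c *\<^sub>R x) k \<le> c * dist x s"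
      using assms by (intro bexI[of _ "c *\<^sub>R s"]) (auto simp: subspace_scale dist_norm simp flip: scaleR_diff_right)
  qed (use subspace_0[OF assms] in auto)
  then show ?thesis using ne by (simp add: infdist_def)
qed

section \<open>Annihilators in the weighted space\<close>

text \<open>Over a discrete index type bounded families are bounded continuous functions, which
  supplies the normed space for the separation argument.\<close>

lemma apply_Bcontfun_discrete:
  fixes h :: "'k::discrete_topology \<Rightarrow> complex"
  assumes "\<And>k. cmod (h k) \<le> B"
  shows "apply_bcontfun (Bcontfun h) = h"
  using assms by (intro Bcontfun_inverse) (auto simp: bcontfun_def bounded_iff intro: continuous_on_discrete)

text \<open>\<open>far\<close> keeps the unit vector at \<open>m\<close> away from \<open>T\<close>,
  so a real functional of norm at most 1 separates them. Its values on coordinate vectors are the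
  sequence \<open>b\<close>, and \<open>c0\<close> makes finite truncations converge, so that
  \<open>b\<close> represents the functional on \<open>T\<close>.\<close>

lemma weighted_c0_annihilator:
  fixes T :: "('k::discrete_topology \<Rightarrow> complex) set" and w :: "'k \<Rightarrow> real"
  assumes w: "\<And>k. 0 < w k"
    and T: "cfun.subspace T"
    and c0: "\<And>h \<epsilon>. h \<in> T \<Longrightarrow> 0 < \<epsilon> \<Longrightarrow> finite {k. \<epsilon> * w k \<le> cmod (h k)}"
    and far: "0 < \<epsilon>" "\<And>h. h \<in> T \<Longrightarrow> \<exists>k. \<epsilon> * w k < cmod (h k - (if k = m then 1 else 0))"
  obtains b where "\<And>A. finite A \<Longrightarrow> (\<Sum>k\<in>A. cmod (b k) * w k) \<le> 1"
    "\<And>h. h \<in> T \<Longrightarrow> ((\<lambda>k. b k * h k) has_sum 0) UNIV" "b m \<noteq> 0"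
proof -
  \<comment> \<open>Dividing by the weight turns the weighted norm into the supremum norm.\<close>
  define emb where "emb h = Bcontfun (\<lambda>k. h k / of_real (w k))" for h :: "'k \<Rightarrow> complex"
  define W where "W = emb ` T"
  have bounded: "\<exists>B. \<forall>k. cmod (h k / of_real (w k)) \<le> B" if "h \<in> T" for h
  proof -
    let ?g = "\<lambda>k. cmod (h k / of_real (w k))"
    have fin: "finite {k. 1 * w k \<le> cmod (h k)}" using c0[OF that zero_less_one] .
    have "?g k \<le> Max (insert 1 (?g ` {k. 1 * w k \<le> cmod (h k)}))" for k
    proof (cases "1 * w k \<le> cmod (h k)")
      case True
      with fin show ?thesis by (intro Max_ge) auto
    next
      case False
      then have "?g k \<le> 1" using w[of k] by (simp add: norm_divide divide_le_eq)
      also have "1 \<le> Max (insert 1 (?g ` {k. 1 * w k \<le> cmod (h k)}))" using fin by (intro Max_ge) auto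
      finally show ?thesis .
    qed
    then show ?thesis by blast
  qed
  have emb: "apply_bcontfun (emb h) k = h k / of_real (w k)" if h: "h \<in> T" for h k
  proof -
    obtain B where "\<And>j. cmod (h j / of_real (w j)) \<le> B" using bounded[OF h] by blast
    from apply_Bcontfun_discrete[where h = "\<lambda>j. h j / of_real (w j)", OF this]
    show ?thesis by (simp add: emb_def)
  qed
  have subW: "subspace W"
  proof (rule subspaceI)
    have "0 \<in> T" using cfun.subspace_0[OF T] .
    moreover have "emb 0 = 0"
      using emb[OF \<open>0 \<in> T\<close>] by (intro bcontfun_eqI) auto
    ultimately show "0 \<in> W" unfolding W_def by force
  next
    fix x y assume "x \<in> W" "y \<in> W"
    then obtain h g where hg: "h \<in> T" "g \<in> T" "x = emb h" "y = emb g" by (auto simp: W_def)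
    then have "h + g \<in> T" using cfun.subspace_add[OF T] by blast
    moreover have "x + y = emb (h + g)"
      using emb hg \<open>h + g \<in> T\<close> by (intro bcontfun_eqI) (simp add: add_divide_distrib)
    ultimately show "x + y \<in> W" by (auto simp: W_def)
  next
    fix c :: real and x assume "x \<in> W"
    then obtain h where h: "h \<in> T" "x = emb h" by (auto simp: W_def)
    then have "cscale (of_real c) h \<in> T" using cfun.subspace_scale[OF T] by blast
    moreover have "c *\<^sub>R x = emb (cscale (of_real c) h)"
      using emb h \<open>cscale (of_real c) h \<in> T\<close>
      by (intro bcontfun_eqI) (simp add: cscale_def scaleR_conv_of_real)
    ultimately show "c *\<^sub>R x \<in> W" by (auto simp: W_def)
  qed
  define e where "e k z = Bcontfun (\<lambda>j. if j = k then z else 0)" for k :: 'k and z :: complex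
  have e: "apply_bcontfun (e k z) j = (if j = k then z else 0)" for k z j
    unfolding e_def using apply_Bcontfun_discrete[of "\<lambda>j. if j = k then z else 0" "cmod z"] by auto
  define v where "v = e m (1 / of_real (w m))"
  have "0 < infdist v W"
  proof -
    have "\<epsilon> \<le> dist v s" if "s \<in> W" for s
    proof -
      from that obtain h where h: "h \<in> T" "s = emb h" by (auto simp: W_def)
      obtain k where k: "\<epsilon> * w k < cmod (h k - (if k = m then 1 else 0))" using far(2)[OF h(1)] by blast
      have "dist (v k) (s k) = cmod (h k - (if k = m then 1 else 0)) / w k"
        using w[of k] w[of m] h by (simp add: v_def e emb dist_norm norm_minus_commute norm_divide flip: diff_divide_distrib)
      then have "\<epsilon> < dist (v k) (s k)" using k w[of k] by (simp add: less_divide_eq)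
      also have "\<dots> \<le> dist v s" by (rule dist_bounded)
      finally show ?thesis by simp
    qed
    moreover have "W \<noteq> {}" using subspace_0[OF subW] by auto
    ultimately have "\<epsilon> \<le> infdist v W" by (auto simp: infdist_def intro: cINF_greatest)
    then show ?thesis using far(1) by linarith
  qed
  obtain f where f: "linear f" "\<And>x. f x \<le> infdist x W" "f v = infdist v W"
    using sublinear_dominates_linear[OF sublinear_infdist[OF subW]] by metis
  have fW: "f s = 0" if "s \<in> W" for s
  proof -
    have "- s \<in> W" using subspace_neg[OF subW that] .
    then show ?thesis using f(2)[of s] f(2)[of "- s"] that linear_neg[OF f(1), of s] by simp
  qed
  have f_le: "f x \<le> norm x" for x
    using f(2)[of x] infdist_le[OF subspace_0[OF subW], of x] by simp
  have f_abs: "\<bar>f x\<bar> \<le> norm x" for x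
    using f_le[of x] f_le[of "- x"] linear_neg[OF f(1), of x] by simp
  \<comment> \<open>The real functional is complexified: \<open>f (e k z) = Re (b' k * z)\<close>
    determines \<open>b' k\<close> from \<open>z = 1\<close> and \<open>z = \<i>\<close>.\<close>
  define b' where "b' k = Complex (f (e k 1)) (- f (e k \<i>))" for k
  have f_e: "f (e k z) = Re (b' k * z)" for k z
  proof -
    have "e k z = Re z *\<^sub>R e k 1 + Im z *\<^sub>R e k \<i>"
      by (rule bcontfun_eqI) (simp add: e complex_eq_iff)
    then show ?thesis
      using f(1) by (simp add: linear_add linear_scale b'_def)
  qed
  have f_sum: "f (\<Sum>k\<in>A. e k (z k)) = Re (\<Sum>k\<in>A. b' k * z k)" for A z
    by (simp only: linear_sum[OF f(1)] f_e Re_sum)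
  have sum_e: "apply_bcontfun (\<Sum>k\<in>A. e k (z k)) j = (if j \<in> A then z j else 0)" if "finite A" for A z j
    using that by (induction A rule: finite_induct) (auto simp: e)
  define b where "b k = b' k / of_real (w k)" for k
  show thesis
  proof (rule that[of b])
    fix A :: "'k set" assume A: "finite A"
    have "(\<Sum>k\<in>A. cmod (b k) * w k) = (\<Sum>k\<in>A. cmod (b' k))"
      using w by (intro sum.cong) (auto simp: b_def norm_divide abs_of_pos less_imp_neq[symmetric])
    \<comment> \<open>The functional is tested on the conjugate phases of \<open>b'\<close>, a
      family of supremum norm at most 1; where \<open>b' k = 0\<close> the quotient is 0 by
      convention.\<close>
    also have "\<dots> = Re (\<Sum>k\<in>A. b' k * (cnj (b' k) / of_real (cmod (b' k))))"
    proof -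
      have "b' k * (cnj (b' k) / of_real (cmod (b' k))) = of_real (cmod (b' k))" for k
        by (simp add: complex_norm_square[symmetric] power2_eq_square)
      then show ?thesis by simp
    qed
    also have "\<dots> = f (\<Sum>k\<in>A. e k (cnj (b' k) / of_real (cmod (b' k))))"
      by (rule f_sum[symmetric])
    also have "\<dots> \<le> norm (\<Sum>k\<in>A. e k (cnj (b' k) / of_real (cmod (b' k))))"
      by (rule f_le)
    also have "\<dots> \<le> 1"
      using A by (intro norm_bound) (auto simp: sum_e norm_divide)
    finally show "(\<Sum>k\<in>A. cmod (b k) * w k) \<le> 1" .
  next
    fix h assume h: "h \<in> T"
    have Re_lim: "((\<lambda>A. Re (\<Sum>k\<in>A. b k * g k)) \<longlongrightarrow> 0) (finite_subsets_at_top UNIV)" if g: "g \<in> T" for g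
    proof (rule tendstoI)
      fix \<delta> :: real assume "0 < \<delta>"
      have fin: "finite {k. \<delta>/2 * w k \<le> cmod (g k)}" using c0[OF g, of "\<delta>/2"] \<open>0 < \<delta>\<close> by simp
      have "dist (Re (\<Sum>k\<in>A. b k * g k)) 0 < \<delta>"
        if A: "finite A" "{k. \<delta>/2 * w k \<le> cmod (g k)} \<subseteq> A" for A
      proof -
        let ?z = "\<lambda>k. g k / of_real (w k)"
        have "Re (\<Sum>k\<in>A. b k * g k) = f (\<Sum>k\<in>A. e k (?z k))"
          by (simp add: f_sum b_def)
        \<comment> \<open>Subtracting \<open>emb g\<close> costs nothing because \<open>f\<close>
          vanishes on \<open>W\<close>; the difference lives off \<open>A\<close>, where
          \<open>g / w\<close> is below \<open>\<delta> / 2\<close>.\<close>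
        also have "\<dots> = f ((\<Sum>k\<in>A. e k (?z k)) - emb g)"
          using fW[of "emb g"] g by (simp add: linear_diff[OF f(1)] W_def)
        also have "\<bar>\<dots>\<bar> \<le> norm ((\<Sum>k\<in>A. e k (?z k)) - emb g)" by (rule f_abs)
        also have "\<dots> \<le> \<delta> / 2"
        proof (rule norm_bound)
          fix j
          have "cmod (g j) / w j \<le> \<delta> / 2" if "j \<notin> A"
          proof -
            have "j \<notin> {k. \<delta>/2 * w k \<le> cmod (g k)}" using that A(2) by blast
            then show ?thesis using w[of j] by (simp add: divide_le_eq)
          qed
          then show "norm (apply_bcontfun ((\<Sum>k\<in>A. e k (?z k)) - emb g) j) \<le> \<delta> / 2"
            using w[of j] \<open>0 < \<delta>\<close> by (simp add: sum_e A emb g norm_divide)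
        qed
        finally show ?thesis using \<open>0 < \<delta>\<close> by (simp add: dist_real_def)
      qed
      with fin show "\<forall>\<^sub>F A in finite_subsets_at_top UNIV. dist (Re (\<Sum>k\<in>A. b k * g k)) 0 < \<delta>"
        unfolding eventually_finite_subsets_at_top by blast
    qed
    \<comment> \<open>\<open>T\<close> is a complex subspace, so the statement on real parts applied
      to \<open>- \<i> h\<close> gives the imaginary parts.\<close>
    have "cscale (- \<i>) h \<in> T" using cfun.subspace_scale[OF T h] .
    from Re_lim[OF this]
    have "((\<lambda>A. Im (\<Sum>k\<in>A. b k * h k)) \<longlongrightarrow> 0) (finite_subsets_at_top UNIV)"
      by (simp add: cscale_def algebra_simps)
    with Re_lim[OF h] show "((\<lambda>k. b k * h k) has_sum 0) UNIV"
      unfolding has_sum_def by (simp add: tendsto_complex_iff)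
  next
    have "Re (b m) = f v" unfolding v_def f_e b_def by simp
    then show "b m \<noteq> 0" using \<open>0 < infdist v W\<close> f(3) by auto
  qed
qed

lemma exp_line_span_bounded:
  fixes h :: "int \<Rightarrow> complex"
  assumes "h \<in> cfun.span ((\<lambda>l k. exp (\<i> * of_real (of_int k * l))) ` L)"
  shows "\<exists>B. \<forall>k. cmod (h k) \<le> B"
  using assms
proof (induction rule: cfun.span_induct_alt)
  case base
  show ?case by auto
next
  case (step c x y)
  then obtain B l where yx: "\<forall>k. cmod (y k) \<le> B" "x = (\<lambda>k. exp (\<i> * of_real (of_int k * l)))" by auto
  have "cmod ((cscale c x + y) k) \<le> cmod c + B" for k
  proof -
    have "cmod (c * x k) = cmod c" using yx by (simp add: norm_mult)
    with yx(1)[rule_format, of k] norm_triangle_ineq[of "c * x k" "y k"] show ?thesis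
      by (simp add: cscale_def)
  qed
  then show ?case by blast
qed

text \<open>Otherwise the unit vector at \<open>m\<close> is separated from the span. The separating
  sequence \<open>b\<close> is the coefficient sequence of a weighted series vanishing on
  \<open>L\<close>, so uniqueness gives \<open>b m = 0\<close>, against the choice of
  \<open>b\<close>.\<close>

theorem exp_line_span_approx_delta:
  fixes \<psi> :: "real \<Rightarrow> real" and m :: int
  assumes nonneg: "\<And>x. 0 \<le> x \<Longrightarrow> 0 \<le> \<psi> x"
    and inc: "mono_on {0..} \<psi>"
    and unbounded: "filterlim \<psi> at_top at_top"
    and div: "\<not> summable (\<lambda>k. \<psi> (real k) / (1 + (real k)\<^sup>2))"
    and L: "L \<in> sets lebesgue" "\<not> negligible L"
    and \<epsilon>: "0 < \<epsilon>"
  shows "\<exists>h \<in> cfun.span ((\<lambda>l k. exp (\<i> * of_real (of_int k * l))) ` L).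
    \<forall>k. cmod (h k - (if k = m then 1 else 0)) \<le> \<epsilon> * exp (\<psi> \<bar>real_of_int k\<bar>)" (is "?thesis")
proof (rule ccontr)
  let ?T = "cfun.span ((\<lambda>l k. exp (\<i> * of_real (of_int k * l))) ` L) :: (int \<Rightarrow> complex) set"
  assume no: "\<not> ?thesis"
  have far: "\<exists>k. \<epsilon> * exp (\<psi> \<bar>real_of_int k\<bar>) < cmod (h k - (if k = m then 1 else 0))" if "h \<in> ?T" for h
    using no that by (auto simp: not_le)
  have c0: "finite {k. \<delta> * exp (\<psi> \<bar>real_of_int k\<bar>) \<le> cmod (h k)}" if h: "h \<in> ?T" "0 < \<delta>" for h \<delta>
  proof -
    obtain B where B: "\<And>k. cmod (h k) \<le> B" using exp_line_span_bounded[OF h(1)] by blast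
    have "eventually (\<lambda>x. B / \<delta> < \<psi> x) at_top" using unbounded by (simp add: filterlim_at_top_dense)
    then obtain X where X: "\<And>x. x \<ge> X \<Longrightarrow> B / \<delta> < \<psi> x" by (auto simp: eventually_at_top_linorder)
    have "{k. \<delta> * exp (\<psi> \<bar>real_of_int k\<bar>) \<le> cmod (h k)} \<subseteq> {- \<lceil>\<bar>X\<bar>\<rceil>..\<lceil>\<bar>X\<bar>\<rceil>}"
    proof
      fix k assume "k \<in> {k. \<delta> * exp (\<psi> \<bar>real_of_int k\<bar>) \<le> cmod (h k)}"
      then have "\<delta> * exp (\<psi> \<bar>real_of_int k\<bar>) \<le> B" using B[of k] by auto
      then have "exp (\<psi> \<bar>real_of_int k\<bar>) \<le> B / \<delta>" using h(2) by (simp add: field_simps)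
      then have "\<psi> \<bar>real_of_int k\<bar> \<le> B / \<delta>" using exp_ge_add_one_self[of "\<psi> \<bar>real_of_int k\<bar>"] by linarith
      then have "\<bar>real_of_int k\<bar> < X" using X[of "\<bar>real_of_int k\<bar>"] by fastforce
      then show "k \<in> {- \<lceil>\<bar>X\<bar>\<rceil>..\<lceil>\<bar>X\<bar>\<rceil>}" by (simp add: abs_less_iff) linarith
    qed
    then show ?thesis using finite_subset by blast
  qed
  obtain b where b: "\<And>A. finite A \<Longrightarrow> (\<Sum>k\<in>A. cmod (b k) * exp (\<psi> \<bar>real_of_int k\<bar>)) \<le> 1"
    "\<And>h. h \<in> ?T \<Longrightarrow> ((\<lambda>k. b k * h k) has_sum 0) UNIV" "b m \<noteq> 0"
    using weighted_c0_annihilator[OF exp_gt_zero cfun.subspace_span c0 \<epsilon> far] by blast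
  interpret weighted_exp_series b \<psi> 1
    using nonneg inc b(1) by unfold_locales
  have "b m = 0"
    by (rule coeff_zero_of_has_sum_zero_on[OF unbounded div L]) (intro b(2) cfun.span_base imageI)
  with b(3) show False by contradiction
qed


section \<open>Density in several dimensions\<close>

abbreviation line_exps :: "real set \<Rightarrow> (int \<Rightarrow> complex) set" where
  "line_exps L \<equiv> (\<lambda>l k. exp (\<i> * of_real (of_int k * l))) ` L"

lemma exp_family_prod:
  "exp_family l k = (\<Prod>j\<in>UNIV. exp (\<i> * of_real (of_int (k $ j) * l $ j)))"
  by (simp add: exp_family_def inner_vec_def lattice_vec_def sum_distrib_left exp_sum mult.commute)

lemma subspace_exp_span: "cfun.subspace (exp_span \<Lambda>)"
  by (simp add: exp_span_def)

text \<open>The product is linear in each factor, and is an exponential when all factors are.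
  Induction on the set \<open>S\<close> of coordinates carrying general span elements frees one
  coordinate at a time.\<close>

lemma tensor_in_exp_span:
  fixes L :: "'n::finite \<Rightarrow> real set"
  assumes "\<And>j. g j \<in> cfun.span (line_exps (L j))"
  shows "(\<lambda>k. \<Prod>j\<in>UNIV. g j (k $ j)) \<in> exp_span (box_product L)"
proof -
  have "(\<lambda>k. \<Prod>j\<in>UNIV. g j (k $ j)) \<in> exp_span (box_product L)"
    if "finite S" "\<And>j. j \<in> S \<Longrightarrow> g j \<in> cfun.span (line_exps (L j))"
      "\<And>j. j \<notin> S \<Longrightarrow> g j \<in> line_exps (L j)" for S and g :: "'n \<Rightarrow> int \<Rightarrow> complex"
    using that
  proof (induction S arbitrary: g rule: finite_induct)
    case empty
    then have "\<forall>j. \<exists>l. l \<in> L j \<and> g j = (\<lambda>k. exp (\<i> * of_real (of_int k * l)))" by auto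
    then obtain l where l: "\<And>j. l j \<in> L j" "\<And>j. g j = (\<lambda>k. exp (\<i> * of_real (of_int k * l j)))"
      by metis
    have "(\<lambda>k. \<Prod>j\<in>UNIV. g j (k $ j)) = exp_family (\<chi> j. l j)"
      by (simp add: fun_eq_iff exp_family_prod l(2))
    moreover have "(\<chi> j. l j) \<in> box_product L" using l(1) by (simp add: box_product_def)
    ultimately show ?case unfolding exp_span_def by (auto intro: cfun.span_base)
  next
    case (insert a S)
    have split: "(\<lambda>k. \<Prod>j\<in>UNIV. (g(a := x)) j (k $ j)) = (\<lambda>k. x (k $ a) * (\<Prod>j\<in>UNIV - {a}. g j (k $ j)))" for x
      by (simp add: fun_eq_iff prod.remove[of UNIV a])
    let ?P = "\<lambda>x. (\<lambda>k. \<Prod>j\<in>UNIV. (g(a := x)) j (k $ j)) \<in> exp_span (box_product L)"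
    have "?P (g a)"
    proof (rule cfun.span_induct[of "g a" "line_exps (L a)" ?P])
      show "g a \<in> cfun.span (line_exps (L a))" using insert.prems by simp
      show "?P x" if "x \<in> line_exps (L a)" for x
      proof (rule insert.IH)
        show "(g(a := x)) j \<in> cfun.span (line_exps (L j))" if "j \<in> S" for j
          using that insert.prems insert.hyps by auto
        show "(g(a := x)) j \<in> line_exps (L j)" if "j \<notin> S" for j
          using that insert.prems \<open>x \<in> line_exps (L a)\<close> by auto
      qed
      show "cfun.subspace {x. ?P x}"
        unfolding split
      proof (rule cfun.subspaceI)
        have "(\<lambda>k. 0 (k $ a) * (\<Prod>j\<in>UNIV - {a}. g j (k $ j))) = (0 :: int ^ 'n \<Rightarrow> complex)"
          by (simp add: fun_eq_iff)
        then show "0 \<in> {x. (\<lambda>k. x (k $ a) * (\<Prod>j\<in>UNIV - {a}. g j (k $ j))) \<in> exp_span (box_product L)}"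
          using cfun.subspace_0[OF subspace_exp_span[of "box_product L"]] by simp
      next
        fix x y
        assume "x \<in> {x. (\<lambda>k. x (k $ a) * (\<Prod>j\<in>UNIV - {a}. g j (k $ j))) \<in> exp_span (box_product L)}"
          "y \<in> {x. (\<lambda>k. x (k $ a) * (\<Prod>j\<in>UNIV - {a}. g j (k $ j))) \<in> exp_span (box_product L)}"
        then have "(\<lambda>k. x (k $ a) * (\<Prod>j\<in>UNIV - {a}. g j (k $ j))) + (\<lambda>k. y (k $ a) * (\<Prod>j\<in>UNIV - {a}. g j (k $ j)))
            \<in> exp_span (box_product L)"
          by (intro cfun.subspace_add[OF subspace_exp_span]) auto
        also have "(\<lambda>k. x (k $ a) * (\<Prod>j\<in>UNIV - {a}. g j (k $ j))) + (\<lambda>k. y (k $ a) * (\<Prod>j\<in>UNIV - {a}. g j (k $ j)))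
            = (\<lambda>k. (x + y) (k $ a) * (\<Prod>j\<in>UNIV - {a}. g j (k $ j)))"
          by (simp add: fun_eq_iff algebra_simps)
        finally show "x + y \<in> {x. (\<lambda>k. x (k $ a) * (\<Prod>j\<in>UNIV - {a}. g j (k $ j))) \<in> exp_span (box_product L)}"
          by simp
      next
        fix c x
        assume "x \<in> {x. (\<lambda>k. x (k $ a) * (\<Prod>j\<in>UNIV - {a}. g j (k $ j))) \<in> exp_span (box_product L)}"
        then have "cscale c (\<lambda>k. x (k $ a) * (\<Prod>j\<in>UNIV - {a}. g j (k $ j))) \<in> exp_span (box_product L)"
          by (intro cfun.subspace_scale[OF subspace_exp_span]) auto
        also have "cscale c (\<lambda>k. x (k $ a) * (\<Prod>j\<in>UNIV - {a}. g j (k $ j)))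
            = (\<lambda>k. (cscale c x) (k $ a) * (\<Prod>j\<in>UNIV - {a}. g j (k $ j)))"
          by (simp add: fun_eq_iff cscale_def mult.assoc)
        finally show "cscale c x \<in> {x. (\<lambda>k. x (k $ a) * (\<Prod>j\<in>UNIV - {a}. g j (k $ j))) \<in> exp_span (box_product L)}"
          by simp
      qed
    qed
    then show ?case by simp
  qed
  from this[of UNIV g] assms show ?thesis by simp
qed

lemma abs_component_le_lattice_norm: "\<bar>real_of_int (k $ j)\<bar> \<le> lattice_norm k"
  using component_le_norm_cart[of "lattice_vec k" j] by (simp add: lattice_norm_def lattice_vec_def)

lemma prod_replace_one:
  fixes u :: "'n::finite \<Rightarrow> int \<Rightarrow> complex"
  shows "(\<Prod>j\<in>UNIV. (u(a := x)) j (k $ j)) = x (k $ a) * (\<Prod>j\<in>UNIV - {a}. u j (k $ j))"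
  by (simp add: prod.remove[of UNIV a])

text \<open>The unit vector is a product of one-dimensional ones, replaced coordinate by coordinate.
  Each replacement makes an error weighted by \<open>\<psi> \<bar>k $ a\<bar>\<close>, which
  monotonicity bounds by \<open>\<psi> (lattice_norm k)\<close>.\<close>

lemma exp_span_approx_delta:
  fixes L :: "'n::finite \<Rightarrow> real set" and \<kappa> :: "int ^ 'n"
  assumes inc: "mono_on {0..} \<psi>"
    and line: "\<And>j m \<epsilon>. 0 < \<epsilon> \<Longrightarrow> \<exists>h\<in>cfun.span (line_exps (L j)).
      \<forall>k. cmod (h k - (if k = m then 1 else 0)) \<le> \<epsilon> * exp (\<psi> \<bar>real_of_int k\<bar>)"
    and "0 < \<epsilon>"
  shows "\<exists>h\<in>exp_span (box_product L).
    \<forall>k. cmod (h k - (if k = \<kappa> then 1 else 0)) \<le> \<epsilon> * exp (\<psi> (lattice_norm k))"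
proof -
  let ?\<delta> = "\<lambda>j k :: int. if k = \<kappa> $ j then 1 else 0 :: complex"
  have "\<exists>u. (\<forall>j\<in>S. u j \<in> cfun.span (line_exps (L j))) \<and> (\<forall>j. j \<notin> S \<longrightarrow> u j = ?\<delta> j) \<and>
      (\<forall>k. cmod ((\<Prod>j\<in>UNIV. u j (k $ j)) - (if k = \<kappa> then 1 else 0)) \<le> \<epsilon> * exp (\<psi> (lattice_norm k)))"
    if "finite S" "0 < \<epsilon>" for S \<epsilon>
    using that
  proof (induction S arbitrary: \<epsilon> rule: finite_induct)
    case empty
    have "(\<Prod>j\<in>UNIV. ?\<delta> j (k $ j)) = (if k = \<kappa> then 1 else 0)" for k :: "int ^ 'n"
      by (auto simp: vec_eq_iff intro!: prod_zero)
    then show ?case using empty by (intro exI[of _ ?\<delta>]) (simp add: less_imp_le)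
  next
    case (insert a S)
    obtain u where u: "\<And>j. j \<in> S \<Longrightarrow> u j \<in> cfun.span (line_exps (L j))" "\<And>j. j \<notin> S \<Longrightarrow> u j = ?\<delta> j"
      "\<And>k. cmod ((\<Prod>j\<in>UNIV. u j (k $ j)) - (if k = \<kappa> then 1 else 0)) \<le> \<epsilon> / 2 * exp (\<psi> (lattice_norm k))"
      using insert.IH[of "\<epsilon> / 2"] insert.prems by auto
    have "\<exists>B. \<forall>k. cmod (u j k) \<le> B" for j
    proof (cases "j \<in> S")
      case True
      then show ?thesis using u(1) exp_line_span_bounded by blast
    next
      case False
      then show ?thesis using u(2) by (intro exI[of _ 1]) auto
    qed
    then obtain B where B: "\<And>j k. cmod (u j k) \<le> B j" by metis
    \<comment> \<open>Bounds the factors other than \<open>a\<close> and is fixed before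
      \<open>h\<close> is chosen, so \<open>h\<close> may be required to approximate within
      \<open>\<epsilon> / (2 * C)\<close>; the summand 1 keeps \<open>C\<close> positive.\<close>
    define C where "C = 1 + (\<Prod>j\<in>UNIV - {a}. B j)"
    have B0: "0 \<le> B j" for j using B[of j 0] norm_ge_zero order_trans by blast
    then have "0 < C" unfolding C_def by (simp add: add_pos_nonneg prod_nonneg)
    have rest: "cmod (\<Prod>j\<in>UNIV - {a}. u j (k $ j)) \<le> C" for k :: "int ^ 'n"
    proof -
      have "cmod (\<Prod>j\<in>UNIV - {a}. u j (k $ j)) \<le> (\<Prod>j\<in>UNIV - {a}. B j)"
        unfolding prod_norm[symmetric] by (intro prod_mono) (auto intro: B)
      then show ?thesis by (simp add: C_def)
    qed
    obtain h where h: "h \<in> cfun.span (line_exps (L a))"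
      "\<And>k. cmod (h k - ?\<delta> a k) \<le> \<epsilon> / (2 * C) * exp (\<psi> \<bar>real_of_int k\<bar>)"
      using line[of "\<epsilon> / (2 * C)" a "\<kappa> $ a"] insert.prems \<open>0 < C\<close> by auto
    have "cmod ((\<Prod>j\<in>UNIV. (u(a := h)) j (k $ j)) - (if k = \<kappa> then 1 else 0)) \<le> \<epsilon> * exp (\<psi> (lattice_norm k))" for k
    proof -
      have ua: "u = u(a := ?\<delta> a)" using u(2)[OF insert.hyps(2)] by auto
      have "(\<Prod>j\<in>UNIV. u j (k $ j)) = ?\<delta> a (k $ a) * (\<Prod>j\<in>UNIV - {a}. u j (k $ j))"
        by (subst ua) (rule prod_replace_one)
      then have "(\<Prod>j\<in>UNIV. (u(a := h)) j (k $ j)) - (\<Prod>j\<in>UNIV. u j (k $ j))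
          = (h (k $ a) - ?\<delta> a (k $ a)) * (\<Prod>j\<in>UNIV - {a}. u j (k $ j))"
        unfolding prod_replace_one by (simp only: left_diff_distrib)
      then have "cmod ((\<Prod>j\<in>UNIV. (u(a := h)) j (k $ j)) - (\<Prod>j\<in>UNIV. u j (k $ j)))
          = cmod (h (k $ a) - ?\<delta> a (k $ a)) * cmod (\<Prod>j\<in>UNIV - {a}. u j (k $ j))"
        by (simp only: norm_mult)
      also have "\<dots> \<le> (\<epsilon> / (2 * C) * exp (\<psi> \<bar>real_of_int (k $ a)\<bar>)) * C"
        using h(2) rest insert.prems \<open>0 < C\<close> by (intro mult_mono) auto
      also have "\<dots> = \<epsilon> / 2 * exp (\<psi> \<bar>real_of_int (k $ a)\<bar>)"
        using \<open>0 < C\<close> by simp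
      also have "\<dots> \<le> \<epsilon> / 2 * exp (\<psi> (lattice_norm k))"
        using insert.prems abs_component_le_lattice_norm[of k a]
          mono_onD[OF inc, of "\<bar>real_of_int (k $ a)\<bar>" "lattice_norm k"]
        by (intro mult_left_mono) (auto simp: lattice_norm_def)
      finally have "cmod ((\<Prod>j\<in>UNIV. (u(a := h)) j (k $ j)) - (\<Prod>j\<in>UNIV. u j (k $ j)))
          \<le> \<epsilon> / 2 * exp (\<psi> (lattice_norm k))" .
      with u(3)[of k] show ?thesis
        using norm_triangle_ineq[of "(\<Prod>j\<in>UNIV. (u(a := h)) j (k $ j)) - (\<Prod>j\<in>UNIV. u j (k $ j))"
            "(\<Prod>j\<in>UNIV. u j (k $ j)) - (if k = \<kappa> then 1 else 0)"]
        by (simp del: fun_upd_apply)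
    qed
    then show ?case
      using u h insert.hyps by (intro exI[of _ "u(a := h)"]) auto
  qed
  from this[of UNIV \<epsilon>] \<open>0 < \<epsilon>\<close> obtain u where u: "\<And>j. u j \<in> cfun.span (line_exps (L j))"
    "\<And>k. cmod ((\<Prod>j\<in>UNIV. u j (k $ j)) - (if k = \<kappa> then 1 else 0)) \<le> \<epsilon> * exp (\<psi> (lattice_norm k))"
    by auto
  then show ?thesis by (intro bexI[OF _ tensor_in_exp_span[OF u(1)]]) auto
qed

lemma exp_span_subset_c_space:
  fixes \<Lambda> :: "(real ^ 'n::finite) set"
  assumes "filterlim \<psi> at_top at_top"
  shows "exp_span \<Lambda> \<subseteq> c_space \<psi>"
proof -
  have sub: "cfun.subspace (c_space \<psi> :: (int ^ 'n \<Rightarrow> complex) set)"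
  proof (rule cfun.subspaceI)
    fix x y :: "int ^ 'n \<Rightarrow> complex" assume "x \<in> c_space \<psi>" "y \<in> c_space \<psi>"
    then show "x + y \<in> c_space \<psi>"
      unfolding c_space_def mem_Collect_eq plus_fun_apply add_divide_distrib
      using tendsto_add[of _ "0::complex" _ _ 0] by simp
  next
    fix c and x :: "int ^ 'n \<Rightarrow> complex" assume "x \<in> c_space \<psi>"
    then show "cscale c x \<in> c_space \<psi>"
      unfolding c_space_def mem_Collect_eq cscale_def times_divide_eq_right[symmetric]
      using tendsto_mult_right_zero by blast
  qed (simp add: c_space_def)
  have "exp_family l \<in> c_space \<psi>" for l :: "real ^ 'n"
  proof -
    have "((\<lambda>x. exp (- \<psi> x)) \<longlongrightarrow> 0) at_top"
      using assms by (intro filterlim_compose[OF exp_at_bot]) (simp add: filterlim_uminus_at_bot)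
    then have lim: "((\<lambda>k::int ^ 'n. exp (- \<psi> (lattice_norm k))) \<longlongrightarrow> 0) (filtercomap lattice_norm at_top)"
      by (rule filterlim_compose) (rule filterlim_filtercomap)
    have "((\<lambda>k. exp_family l k / of_real (exp (\<psi> (lattice_norm k)))) \<longlongrightarrow> 0) (filtercomap lattice_norm at_top)"
      by (rule Lim_null_comparison[OF _ lim]) (simp add: exp_family_def norm_mult norm_inverse exp_minus divide_inverse)
    then show ?thesis by (simp add: c_space_def)
  qed
  then show ?thesis
    unfolding exp_span_def by (intro cfun.span_minimal sub) auto
qed

text \<open>Finitely supported families are dense, so approximating unit vectors is enough.\<close>

lemma dense_subspace_exp_span:
  fixes \<Lambda> :: "(real ^ 'n::finite) set"
  assumes unbounded: "filterlim \<psi> at_top at_top"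
    and delta: "\<And>\<kappa> \<epsilon>. 0 < \<epsilon> \<Longrightarrow> \<exists>h\<in>exp_span \<Lambda>.
      \<forall>k. cmod (h k - (if k = \<kappa> then 1 else 0)) \<le> \<epsilon> * exp (\<psi> (lattice_norm k))"
  shows "dense_subspace \<psi> (exp_span \<Lambda>)"
  unfolding dense_subspace_iff
proof (intro conjI ballI allI impI subspace_exp_span exp_span_subset_c_space unbounded)
  fix a :: "int ^ 'n \<Rightarrow> complex" and \<epsilon> :: real
  assume a: "a \<in> c_space \<psi>" and "0 < \<epsilon>"
  then have "\<forall>\<^sub>F k in filtercomap lattice_norm at_top.
      dist (a k / of_real (exp (\<psi> (lattice_norm k)))) 0 < \<epsilon> / 2"
    unfolding c_space_def by (intro tendstoD) auto
  then obtain r where r: "\<And>k. lattice_norm k \<ge> r \<Longrightarrow> cmod (a k) / exp (\<psi> (lattice_norm k)) < \<epsilon> / 2"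
    by (auto simp: eventually_filtercomap eventually_at_top_linorder norm_divide)
  define A where "A = {k :: int ^ 'n. lattice_norm k < r}"
  have A: "finite A" unfolding A_def by (rule finite_lattice_ball)
  \<comment> \<open>With \<open>\<eta> = \<epsilon> / (4 * s)\<close> the errors at the points of
    \<open>A\<close> total at most \<open>\<epsilon> / 4\<close>. The truncation costs
    \<open>\<epsilon> / 2\<close>, and the slack keeps the supremum strictly below
    \<open>\<epsilon>\<close>.\<close>
  define s where "s = 1 + (\<Sum>\<kappa>\<in>A. cmod (a \<kappa>))"
  define \<eta> where "\<eta> = \<epsilon> / (4 * s)"
  have pos: "0 < s" by (simp add: s_def add_pos_nonneg sum_nonneg)
  then have "0 < \<eta>" using \<open>0 < \<epsilon>\<close> by (simp add: \<eta>_def)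
  from delta[OF this] obtain h where h: "\<And>\<kappa>. h \<kappa> \<in> exp_span \<Lambda>"
    "\<And>\<kappa> k. cmod (h \<kappa> k - (if k = \<kappa> then 1 else 0)) \<le> \<eta> * exp (\<psi> (lattice_norm k))"
    by metis
  define f where "f = (\<Sum>\<kappa>\<in>A. cscale (a \<kappa>) (h \<kappa>))"
  have f_apply: "f k = (\<Sum>\<kappa>\<in>A. a \<kappa> * h \<kappa> k)" for k
    unfolding f_def using A by (induction A rule: finite_induct) (auto simp: cscale_def)
  have "f \<in> exp_span \<Lambda>"
    unfolding f_def using h(1)
    by (intro cfun.subspace_sum[OF subspace_exp_span] cfun.subspace_scale[OF subspace_exp_span])
  moreover have "c_norm \<psi> (a - f) \<le> 3 * \<epsilon> / 4"
  proof (rule c_norm_le)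
    fix k :: "int ^ 'n"
    let ?w = "exp (\<psi> (lattice_norm k))"
    have "(a - f) k = (if k \<in> A then 0 else a k) - (\<Sum>\<kappa>\<in>A. a \<kappa> * (h \<kappa> k - (if k = \<kappa> then 1 else 0)))"
      using A by (simp add: f_apply right_diff_distrib sum_subtractf if_distrib[of "(*) _"] cong: if_cong)
    also have "cmod \<dots> \<le> cmod (if k \<in> A then 0 else a k)
        + cmod (\<Sum>\<kappa>\<in>A. a \<kappa> * (h \<kappa> k - (if k = \<kappa> then 1 else 0)))"
      by (rule norm_triangle_ineq4)
    also have "cmod (if k \<in> A then 0 else a k) \<le> \<epsilon> / 2 * ?w"
    proof (cases "k \<in> A")
      case False
      with r[of k] show ?thesis by (simp add: A_def divide_less_eq less_imp_le)
    qed (use \<open>0 < \<epsilon>\<close> in simp)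
    also have "cmod (\<Sum>\<kappa>\<in>A. a \<kappa> * (h \<kappa> k - (if k = \<kappa> then 1 else 0))) \<le> (\<Sum>\<kappa>\<in>A. cmod (a \<kappa>) * (\<eta> * ?w))"
      by (rule order_trans[OF norm_sum]) (auto simp only: norm_mult intro!: sum_mono mult_left_mono h(2) norm_ge_zero)
    also have "\<dots> = (\<Sum>\<kappa>\<in>A. cmod (a \<kappa>)) * \<eta> * ?w"
      by (simp add: sum_distrib_right mult.assoc)
    also have "\<dots> \<le> s * \<eta> * ?w"
      using \<open>0 < \<eta>\<close> by (intro mult_right_mono) (auto simp: s_def)
    also have "\<dots> = \<epsilon> / 4 * ?w" using pos by (simp add: \<eta>_def)
    finally show "cmod ((a - f) k) / ?w \<le> 3 * \<epsilon> / 4" by (simp add: divide_le_eq field_simps)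
  qed
  ultimately show "\<exists>f\<in>exp_span \<Lambda>. c_norm \<psi> (a - f) < \<epsilon>"
    using \<open>0 < \<epsilon>\<close> by (intro bexI[of _ f]) auto
qed


section \<open>Kernels supported on a short interval\<close>

text \<open>\<open>M\<close> times the Fejer mean. Without the factor \<open>1 / M\<close>,
  vanishing at \<open>\<theta>\<close> shows as boundedness in \<open>M\<close>.\<close>

definition cesaro_exp_sum :: "(int \<Rightarrow> real) \<Rightarrow> nat \<Rightarrow> real \<Rightarrow> complex" where
  "cesaro_exp_sum c M \<theta> =
     (\<Sum>m<M. \<Sum>k\<in>{- int m..int m}. of_real (c k) * exp (\<i> * of_real (of_int k * \<theta>)))"

text \<open>Constant coefficients are those of the point mass at 0. Here the sum is \<open>M\<close>
  times the Fejer kernel, whose closed form has a bounded numerator and the denominator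
  \<open>(1 - e 1)\<^sup>2\<close>, bounded away from 0 off a neighbourhood of 0.\<close>

lemma cesaro_exp_sum_const_bounded:
  assumes "0 < A" "A \<le> pi"
  obtains C where "\<And>M \<theta>. \<theta> \<in> {A..2 * pi - A} \<Longrightarrow> cmod (cesaro_exp_sum (\<lambda>_. 1) M \<theta>) \<le> C"
proof (rule that)
  fix M \<theta> assume \<theta>: "\<theta> \<in> {A..2 * pi - A}"
  define e where "e k = exp (\<i> * of_real (of_int k * \<theta>))" for k :: int
  have e_add: "e (k + l) = e k * e l" for k l
    by (simp add: e_def algebra_simps flip: exp_add)
  have norm_e: "cmod (e k) = 1" for k by (simp add: e_def)
  have e0: "e 0 = 1" by (simp add: e_def)
  \<comment> \<open>One factor \<open>1 - e 1\<close> telescopes the inner Dirichlet sum; a second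
    one, in \<open>T\<close>, telescopes the outer sum.\<close>
  have D: "(1 - e 1) * (\<Sum>k\<in>{- int m..int m}. e k) = e (- int m) - e (int m + 1)" for m
  proof (induction m)
    case (Suc m)
    have "{- int (Suc m)..int (Suc m)} = insert (- int m - 1) (insert (int m + 1) {- int m..int m})" by auto
    then have "(\<Sum>k\<in>{- int (Suc m)..int (Suc m)}. e k) = e (- int m - 1) + e (int m + 1) + (\<Sum>k\<in>{- int m..int m}. e k)"
      by simp
    then have "(1 - e 1) * (\<Sum>k\<in>{- int (Suc m)..int (Suc m)}. e k)
        = (1 - e 1) * (e (- int m - 1) + e (int m + 1)) + (e (- int m) - e (int m + 1))"
      by (simp only: distrib_left Suc)
    also have "\<dots> = e (- int m - 1) - e (int m + 1 + 1)"
      using e_add[of "- int m - 1" 1] e_add[of "int m + 1" 1] by (simp add: algebra_simps)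
    moreover have "- int m - 1 = - int (Suc m)" "int m + 1 + 1 = int (Suc m) + 1" by auto
    ultimately show ?case by (simp only:)
  qed (simp add: e0)
  have T: "(1 - e 1)\<^sup>2 * (\<Sum>m<M. \<Sum>k\<in>{- int m..int m}. e k) = e (1 - int M) - 2 * e 1 + e (int M + 1)" for M
  proof (induction M)
    case (Suc M)
    have "(1 - e 1)\<^sup>2 * (\<Sum>m<Suc M. \<Sum>k\<in>{- int m..int m}. e k)
        = (1 - e 1)\<^sup>2 * (\<Sum>m<M. \<Sum>k\<in>{- int m..int m}. e k)
          + (1 - e 1) * ((1 - e 1) * (\<Sum>k\<in>{- int M..int M}. e k))"
      by (simp add: distrib_left power2_eq_square mult.assoc)
    also have "\<dots> = (e (1 - int M) - 2 * e 1 + e (int M + 1)) + (1 - e 1) * (e (- int M) - e (int M + 1))"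
      by (simp only: Suc D)
    also have "\<dots> = e (- int M) - 2 * e 1 + e (int M + 1 + 1)"
      using e_add[of "- int M" 1] e_add[of "int M + 1" 1] by (simp add: algebra_simps)
    finally show ?case by (simp add: algebra_simps)
  qed simp
  have gap: "(cmod (1 - e 1))\<^sup>2 \<ge> 2 - 2 * cos A"
  proof -
    have "cos \<theta> \<le> cos A"
    proof (cases "\<theta> \<le> pi")
      case True
      then show ?thesis using \<theta> assms by (intro cos_monotone_0_pi_le) auto
    next
      case False
      then have "cos (2 * pi - \<theta>) \<le> cos A" using \<theta> assms by (intro cos_monotone_0_pi_le) auto
      then show ?thesis by (simp add: cos_diff)
    qed
    moreover have "(cmod (1 - e 1))\<^sup>2 = 2 - 2 * cos \<theta>"
      unfolding cmod_power2 e_def by (simp add: Re_exp Im_exp power2_eq_square algebra_simps)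
    ultimately show ?thesis by linarith
  qed
  have pos: "0 < 2 - 2 * cos A"
    using cos_monotone_0_pi[of 0 A] assms by simp
  have "(cmod (1 - e 1))\<^sup>2 * cmod (cesaro_exp_sum (\<lambda>_. 1) M \<theta>) = cmod (e (1 - int M) - 2 * e 1 + e (int M + 1))"
    using T[of M, symmetric] by (simp add: cesaro_exp_sum_def e_def norm_mult norm_power)
  also have "\<dots> \<le> cmod (e (1 - int M)) + cmod (2 * e 1) + cmod (e (int M + 1))"
    using norm_triangle_ineq4[of "e (1 - int M)" "2 * e 1"]
      norm_triangle_ineq[of "e (1 - int M) - 2 * e 1" "e (int M + 1)"] by linarith
  also have "\<dots> = 4" by (simp add: norm_e norm_mult)
  finally have "(2 - 2 * cos A) * cmod (cesaro_exp_sum (\<lambda>_. 1) M \<theta>) \<le> 4"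
    using mult_right_mono[OF gap norm_ge_zero[of "cesaro_exp_sum (\<lambda>_. 1) M \<theta>"]] by linarith
  then show "cmod (cesaro_exp_sum (\<lambda>_. 1) M \<theta>) \<le> 4 / (2 - 2 * cos A)"
    using pos by (simp add: pos_le_divide_eq mult.commute)
qed

text \<open>Multiplying coefficients by \<open>sinc (a * of_int k)\<close> convolves with the
  uniform distribution on \<open>{-a..a}\<close>: the support grows by \<open>a\<close> on each
  side, and the constant \<open>C\<close> is unchanged.\<close>

lemma cesaro_exp_sum_sinc:
  assumes "0 < a" "\<And>\<theta>. \<theta> \<in> {A..2 * pi - A} \<Longrightarrow> cmod (cesaro_exp_sum c M \<theta>) \<le> C"
    and \<theta>: "\<theta> \<in> {A + a..2 * pi - (A + a)}"
  shows "cmod (cesaro_exp_sum (\<lambda>k. c k * sinc (a * of_int k)) M \<theta>) \<le> C"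
proof -
  let ?I = "Sigma {..<M} (\<lambda>m. {- int m..int m})"
  have flat: "cesaro_exp_sum d M t = (\<Sum>i\<in>?I. of_real (d (snd i)) * exp (\<i> * of_real (of_int (snd i) * t)))" for d t
    unfolding cesaro_exp_sum_def by (simp add: sum.Sigma case_prod_unfold)
  have "cmod (\<Sum>i\<in>?I. of_real (c (snd i)) * of_real (sinc (a * of_int (snd i))) *
      exp (\<i> * of_real (of_int (snd i) * \<theta>))) \<le> C"
  proof (rule exp_sum_average[OF _ \<open>0 < a\<close>])
    fix t assume "t \<in> {-a..a}"
    then have "\<theta> + t \<in> {A..2 * pi - A}" using \<theta> by auto
    then show "cmod (\<Sum>i\<in>?I. of_real (c (snd i)) * exp (\<i> * of_real (of_int (snd i) * (\<theta> + t)))) \<le> C"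
      using assms(2) unfolding flat by blast
  qed auto
  then show ?thesis unfolding flat by simp
qed

lemma cesaro_exp_sum_sinc_power:
  assumes "0 < a" "\<And>\<theta>. \<theta> \<in> {A..2 * pi - A} \<Longrightarrow> cmod (cesaro_exp_sum c M \<theta>) \<le> C"
    and "\<theta> \<in> {A + real n * a..2 * pi - (A + real n * a)}"
  shows "cmod (cesaro_exp_sum (\<lambda>k. c k * sinc (a * of_int k) ^ n) M \<theta>) \<le> C"
  using assms(3)
proof (induction n arbitrary: \<theta>)
  case (Suc n)
  have "cmod (cesaro_exp_sum (\<lambda>k. c k * sinc (a * of_int k) ^ n * sinc (a * of_int k)) M \<theta>) \<le> C"
    by (rule cesaro_exp_sum_sinc[OF \<open>0 < a\<close> Suc.IH]) (use Suc.prems in \<open>auto simp: algebra_simps\<close>)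
  then show ?case by (simp add: mult_ac)
qed (use assms(2) in simp)

lemma cesaro_exp_sum_sinc_prod:
  fixes a :: "nat \<Rightarrow> real" and n :: "nat \<Rightarrow> nat"
  assumes "\<And>m. 0 < a m" "\<And>\<theta>. \<theta> \<in> {A..2 * pi - A} \<Longrightarrow> cmod (cesaro_exp_sum (\<lambda>_. 1) M \<theta>) \<le> C"
    and "\<theta> \<in> {A + (\<Sum>m<Q. real (n m) * a m)..2 * pi - (A + (\<Sum>m<Q. real (n m) * a m))}"
  shows "cmod (cesaro_exp_sum (\<lambda>k. \<Prod>m<Q. sinc (a m * of_int k) ^ n m) M \<theta>) \<le> C"
  using assms(3)
proof (induction Q arbitrary: \<theta>)
  case (Suc Q)
  have "cmod (cesaro_exp_sum (\<lambda>k. (\<Prod>m<Q. sinc (a m * of_int k) ^ n m) * sinc (a Q * of_int k) ^ n Q) M \<theta>) \<le> C"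
    by (rule cesaro_exp_sum_sinc_power[OF assms(1) Suc.IH]) (use Suc.prems in \<open>auto simp: algebra_simps\<close>)
  then show ?case by simp
qed (use assms(2) in simp)

section \<open>Infinite products of sinc factors\<close>

lemma abs_sinc_le_1: "\<bar>sinc x\<bar> \<le> 1"
  using abs_sin_x_le_abs_x[of x] by (simp add: sinc_def divide_le_eq_1)

lemma abs_sinc_le_inverse: "x \<noteq> 0 \<Longrightarrow> \<bar>sinc x\<bar> \<le> 1 / \<bar>x\<bar>"
  using abs_sin_le_one[of x] by (auto simp: sinc_def divide_right_mono)

text \<open>Even powers make the partial products monotone, so that the infinite product exists.\<close>

lemma sinc_product_kernel:
  fixes a :: "nat \<Rightarrow> real" and q :: "nat \<Rightarrow> nat"
  assumes a: "\<And>m. 0 < a m" and total: "\<And>Q. (\<Sum>m<Q. real (2 * q m) * a m) \<le> 1 / 2"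
  obtains b :: "int \<Rightarrow> real" where "\<And>k. 0 \<le> b k" "\<And>k. b k \<le> 1" "b 0 = 1"
    "\<And>k m. b k \<le> sinc (a m * of_int k) ^ (2 * q m)"
    "\<And>\<theta>. \<theta> \<in> {1..2 * pi - 1} \<Longrightarrow> \<exists>C. \<forall>M. cmod (cesaro_exp_sum b M \<theta>) \<le> C"
proof -
  define f where "f m k = sinc (a m * of_int k) ^ (2 * q m)" for m and k :: int
  have f: "0 \<le> f m k" "f m k \<le> 1" for m k
    using power_le_one[of "\<bar>sinc (a m * of_int k)\<bar>" "2 * q m"] abs_sinc_le_1
    by (simp_all add: f_def power_even_abs)
  define B where "B Q k = (\<Prod>m<Q. f m k)" for Q k
  have B: "0 \<le> B Q k" "B Q k \<le> 1" for Q k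
    unfolding B_def by (auto intro!: prod_nonneg prod_le_1 simp: f)
  have dec: "decseq (\<lambda>Q. B Q k)" for k
    using B f by (auto intro!: decseq_SucI mult_left_le simp: B_def prod_nonneg)
  define b where "b k = (INF Q. B Q k)" for k
  have bdd: "bdd_below (range (\<lambda>Q. B Q k))" for k by (intro bdd_belowI2[of _ 0]) (simp add: B)
  have lim: "(\<lambda>Q. B Q k) \<longlonglongrightarrow> b k" for k
    unfolding b_def by (rule LIMSEQ_decseq_INF[OF bdd dec])
  have b_le: "b k \<le> B Q k" for Q k
    unfolding b_def by (rule cINF_lower[OF bdd]) simp
  show thesis
  proof (rule that[of b])
    show "0 \<le> b k" for k unfolding b_def using B by (intro cINF_greatest) auto
    show "b k \<le> 1" for k using b_le[of k 0] by (simp add: B_def)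
    have "B Q 0 = 1" for Q by (simp add: B_def f_def sinc_def)
    then show "b 0 = 1" by (simp add: b_def)
    show "b k \<le> sinc (a m * of_int k) ^ (2 * q m)" for k m
    proof -
      have "B (Suc m) k \<le> f m k"
        using B[of m k] f[of m k] by (simp add: B_def mult_left_le_one_le prod_nonneg)
      with b_le[of k "Suc m"] show ?thesis by (simp add: f_def)
    qed
    fix \<theta> :: real assume \<theta>: "\<theta> \<in> {1..2 * pi - 1}"
    \<comment> \<open>Radius 1/2 around the point mass plus total width at most 1/2 from the factors
      gives the radius 1; \<open>C\<close> is independent of \<open>Q\<close>, so the bound passes
      to the limit.\<close>
    have "(1/2 :: real) \<le> pi" using pi_gt3 by simp
    then obtain C where C: "\<And>M \<theta>. \<theta> \<in> {1/2..2 * pi - 1/2} \<Longrightarrow> cmod (cesaro_exp_sum (\<lambda>_. 1) M \<theta>) \<le> C"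
      using cesaro_exp_sum_const_bounded[of "1/2"] by auto
    have bound: "cmod (cesaro_exp_sum (B Q) M \<theta>) \<le> C" for Q M
    proof -
      have "\<theta> \<in> {1/2 + (\<Sum>m<Q. real (2 * q m) * a m)..2 * pi - (1/2 + (\<Sum>m<Q. real (2 * q m) * a m))}"
        using \<theta> total[of Q] by auto
      from cesaro_exp_sum_sinc_prod[OF a C this]
      have "cmod (cesaro_exp_sum (\<lambda>k. \<Prod>m<Q. sinc (a m * of_int k) ^ (2 * q m)) M \<theta>) \<le> C" .
      then show ?thesis unfolding B_def f_def .
    qed
    have "cmod (cesaro_exp_sum b M \<theta>) \<le> C" for M
    proof (rule tendsto_upperbound)
      show "(\<lambda>Q. cmod (cesaro_exp_sum (B Q) M \<theta>)) \<longlonglongrightarrow> cmod (cesaro_exp_sum b M \<theta>)"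
        unfolding cesaro_exp_sum_def by (intro tendsto_intros lim)
    qed (use bound in auto)
    then show "\<exists>C. \<forall>M. cmod (cesaro_exp_sum b M \<theta>) \<le> C" by blast
  qed
qed

text \<open>If \<open>l\<close> were nonzero, the terms would eventually have a component of at
  least a fixed size in the direction of \<open>l\<close>, and their sums would grow
  linearly.\<close>

lemma limit_zero_of_bounded_sums:
  fixes s :: "nat \<Rightarrow> complex"
  assumes lim: "s \<longlonglongrightarrow> l" and bounded: "\<And>M. cmod (\<Sum>m<M. s m) \<le> C"
  shows "l = 0"
proof (rule ccontr)
  assume "l \<noteq> 0"
  define d where "d = (cmod l)\<^sup>2 / 2"
  have "0 < d" using \<open>l \<noteq> 0\<close> by (simp add: d_def)
  have "(\<lambda>m. Re (cnj l * s m)) \<longlonglongrightarrow> Re (cnj l * l)" using lim by (intro tendsto_intros)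
  moreover have "Re (cnj l * l) = 2 * d" by (simp add: d_def cmod_power2 flip: power2_eq_square)
  ultimately have "\<forall>\<^sub>F m in sequentially. d < Re (cnj l * s m)"
    using \<open>0 < d\<close> by (intro order_tendstoD(1)) auto
  then obtain m0 where m0: "\<And>m. m \<ge> m0 \<Longrightarrow> d < Re (cnj l * s m)"
    by (auto simp: eventually_sequentially)
  have grow: "real n * d \<le> Re (cnj l * (\<Sum>m=m0..<m0 + n. s m))" for n
  proof (induction n)
    case (Suc n)
    then show ?case using m0[of "m0 + n"] by (simp add: algebra_simps)
  qed simp
  have "real n * d \<le> cmod l * (2 * C)" for n
  proof -
    have "(\<Sum>m=m0..<m0 + n. s m) = (\<Sum>m<m0 + n. s m) - (\<Sum>m<m0. s m)"
      using sum_diff_nat_ivl[of 0 m0 "m0 + n" s] by (simp add: lessThan_atLeast0)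
    then have "cmod (\<Sum>m=m0..<m0 + n. s m) \<le> 2 * C"
      using norm_triangle_ineq4[of "\<Sum>m<m0 + n. s m" "\<Sum>m<m0. s m"] bounded[of "m0 + n"] bounded[of m0] by simp
    then have "cmod (cnj l * (\<Sum>m=m0..<m0 + n. s m)) \<le> cmod l * (2 * C)"
      by (simp add: norm_mult mult_left_mono)
    with grow[of n] complex_Re_le_cmod[of "cnj l * (\<Sum>m=m0..<m0 + n. s m)"] show ?thesis by linarith
  qed
  moreover obtain n :: nat where "cmod l * (2 * C) < real n * d"
    using ex_less_of_nat_mult[OF \<open>0 < d\<close>] by blast
  ultimately show False by (meson not_less)
qed

lemma filterlim_symmetric_intervals:
  "filterlim (\<lambda>m. {- int m..int m}) (finite_subsets_at_top UNIV) sequentially"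
  unfolding filterlim_finite_subsets_at_top
proof (intro allI impI)
  fix X :: "int set" assume X: "finite X \<and> X \<subseteq> UNIV"
  have "X \<subseteq> {- int m..int m}" if "m \<ge> Max (insert 0 ((\<lambda>k. nat \<bar>k\<bar>) ` X))" for m
  proof
    fix k assume "k \<in> X"
    then have "nat \<bar>k\<bar> \<le> Max (insert 0 ((\<lambda>k. nat \<bar>k\<bar>) ` X))" using X by (intro Max_ge) auto
    then have "nat \<bar>k\<bar> \<le> m" using that by simp
    then show "k \<in> {- int m..int m}" by auto
  qed
  then show "\<forall>\<^sub>F m in sequentially. finite {- int m..int m} \<and> X \<subseteq> {- int m..int m} \<and> {- int m..int m} \<subseteq> UNIV"
    unfolding eventually_sequentially by blast
qed

text \<open>Absolute summability makes the symmetric partial sums converge to the value of the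
  series; boundedness of their running sums leaves only the value 0.\<close>

lemma has_sum_zero_of_bounded_cesaro:
  fixes b :: "int \<Rightarrow> real"
  assumes "\<And>A. finite A \<Longrightarrow> (\<Sum>k\<in>A. \<bar>b k\<bar>) \<le> W"
    and "\<And>M. cmod (cesaro_exp_sum b M \<theta>) \<le> C"
  shows "((\<lambda>k. of_real (b k) * exp (\<i> * of_real (of_int k * \<theta>))) has_sum 0) UNIV"
proof -
  let ?g = "\<lambda>k. of_real (b k) * exp (\<i> * of_real (of_int k * \<theta>))"
  have "(\<lambda>k. \<bar>b k\<bar>) summable_on UNIV"
    using assms(1) by (intro nonneg_bdd_above_summable_on bdd_aboveI2) auto
  then have "(\<lambda>k. cmod (?g k)) summable_on UNIV" by (simp add: norm_mult)
  then have "?g summable_on UNIV" by (rule abs_summable_summable)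
  then obtain l where l: "(?g has_sum l) UNIV" by (auto simp: summable_on_def)
  then have "(\<lambda>m. \<Sum>k\<in>{- int m..int m}. ?g k) \<longlonglongrightarrow> l"
    unfolding has_sum_def by (rule filterlim_compose) (rule filterlim_symmetric_intervals)
  moreover have "cmod (\<Sum>m<M. \<Sum>k\<in>{- int m..int m}. ?g k) \<le> C" for M
    using assms(2)[of M] by (simp add: cesaro_exp_sum_def)
  ultimately have "l = 0" by (rule limit_zero_of_bounded_sums)
  then show ?thesis using l by simp
qed

section \<open>Dyadic form of the convergent series and decay of the kernel\<close>

lemma sum_int_inverse_square_le:
  assumes "finite A"
  shows "(\<Sum>k\<in>A. 1 / (1 + (real_of_int k)\<^sup>2)) \<le> 5"
proof -
  \<comment> \<open>Strengthened for the induction: the bound is 1 at \<open>n = 0\<close>, and each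
    new pair \<open>k = n + 1\<close>, \<open>k = - n - 1\<close> costs twice a telescoping
    difference.\<close>
  have sym: "(\<Sum>k\<in>{- int n..int n}. 1 / (1 + (real_of_int k)\<^sup>2)) \<le> 5 - 4 / (real n + 1)" for n
  proof (induction n)
    case (Suc n)
    have "{- int (Suc n)..int (Suc n)} = insert (- int n - 1) (insert (int n + 1) {- int n..int n})" by auto
    then have "(\<Sum>k\<in>{- int (Suc n)..int (Suc n)}. 1 / (1 + (real_of_int k)\<^sup>2)) =
        1 / (1 + (- real n - 1)\<^sup>2) + (1 / (1 + (real n + 1)\<^sup>2) + (\<Sum>k\<in>{- int n..int n}. 1 / (1 + (real_of_int k)\<^sup>2)))"
      by simp
    also have "(- real n - 1)\<^sup>2 = (real n + 1)\<^sup>2" by (simp add: power2_eq_square algebra_simps)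
    finally have "(\<Sum>k\<in>{- int (Suc n)..int (Suc n)}. 1 / (1 + (real_of_int k)\<^sup>2))
        \<le> 2 * (1 / (1 + (real n + 1)\<^sup>2)) + (5 - 4 / (real n + 1))"
      using Suc by linarith
    moreover have "1 / (1 + (real (n + 1))\<^sup>2) \<le> 2 / real (n + 1) - 2 / real (n + 2)"
      using sum_inverse_square_le[of "n + 1" "n + 2"] by simp
    ultimately show ?case by (simp add: algebra_simps)
  qed simp
  define n where "n = Max (insert 0 ((\<lambda>k. nat \<bar>k\<bar>) ` A))"
  have "A \<subseteq> {- int n..int n}"
  proof
    fix k assume "k \<in> A"
    then have "nat \<bar>k\<bar> \<le> n" using assms unfolding n_def by (intro Max_ge) auto
    then show "k \<in> {- int n..int n}" by auto
  qed
  then have "(\<Sum>k\<in>A. 1 / (1 + (real_of_int k)\<^sup>2)) \<le> (\<Sum>k\<in>{- int n..int n}. 1 / (1 + (real_of_int k)\<^sup>2))"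
    by (intro sum_mono2) (auto simp: add_nonneg_nonneg)
  also have "\<dots> \<le> 5" using sym[of n] by (rule order_trans) simp
  finally show ?thesis .
qed

text \<open>Cauchy condensation. The block from \<open>2 ^ Q\<close> has \<open>2 ^ Q\<close> terms,
  each with denominator at most \<open>8 * (2 ^ Q)\<^sup>2\<close>, hence the constant 8.\<close>

lemma sum_dyadic_le:
  fixes \<psi> :: "real \<Rightarrow> real"
  assumes nonneg: "\<And>x. 0 \<le> x \<Longrightarrow> 0 \<le> \<psi> x" and inc: "mono_on {0..} \<psi>"
  shows "(\<Sum>m<Q. \<psi> (2 ^ m) / 2 ^ m) \<le> 8 * (\<Sum>k<2 ^ Q. \<psi> (real k) / (1 + (real k)\<^sup>2))"
proof (induction Q)
  case 0
  show ?case using nonneg[of 0] by simp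
next
  case (Suc Q)
  let ?g = "\<lambda>k. \<psi> (real k) / (1 + (real k)\<^sup>2)"
  have "\<psi> (2 ^ Q) / (8 * 2 ^ Q) = (\<Sum>k=2 ^ Q..<(2 :: nat) ^ Suc Q. \<psi> (2 ^ Q) / (8 * (2 ^ Q)\<^sup>2))"
    by (simp add: power2_eq_square field_simps)
  also have "\<dots> \<le> (\<Sum>k=2 ^ Q..<2 ^ Suc Q. ?g k)"
  proof (rule sum_mono)
    fix k :: nat assume k: "k \<in> {2 ^ Q..<2 ^ Suc Q}"
    then have "2 ^ Q \<le> k" "k \<le> 2 * 2 ^ Q" by auto
    then have "real (2 ^ Q) \<le> real k" "real k \<le> real (2 * 2 ^ Q)" by (simp_all only: of_nat_le_iff)
    then have k': "2 ^ Q \<le> real k" "real k \<le> 2 * 2 ^ Q" by simp_all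
    have "(real k)\<^sup>2 \<le> (2 * 2 ^ Q)\<^sup>2" using k' by (intro power_mono) auto
    then have "(real k)\<^sup>2 \<le> 4 * (2 ^ Q)\<^sup>2" by (simp add: power_mult_distrib)
    moreover have "(1::real) \<le> (2 ^ Q)\<^sup>2" by (simp add: one_le_power)
    ultimately have "1 + (real k)\<^sup>2 \<le> 8 * (2 ^ Q)\<^sup>2" by linarith
    moreover have "\<psi> (2 ^ Q) \<le> \<psi> (real k)" using mono_onD[OF inc, of "2 ^ Q" "real k"] k' by simp
    ultimately show "\<psi> (2 ^ Q) / (8 * (2 ^ Q)\<^sup>2) \<le> ?g k"
      using nonneg[of "2 ^ Q"] nonneg[of "real k"] by (intro frac_le) (auto simp: add_pos_nonneg)
  qed
  finally have "\<psi> (2 ^ Q) / 2 ^ Q \<le> 8 * (\<Sum>k=2 ^ Q..<2 ^ Suc Q. ?g k)" by (simp add: field_simps)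
  moreover have "(\<Sum>k<2 ^ Suc Q. ?g k) = (\<Sum>k<2 ^ Q. ?g k) + (\<Sum>k=2 ^ Q..<2 ^ Suc Q. ?g k)"
    using sum.atLeastLessThan_concat[of 0 "2 ^ Q" "2 ^ Suc Q" ?g] by (simp add: lessThan_atLeast0)
  ultimately show ?case using Suc by (simp add: distrib_left)
qed

lemma summable_dyadic:
  fixes \<psi> :: "real \<Rightarrow> real"
  assumes nonneg: "\<And>x. 0 \<le> x \<Longrightarrow> 0 \<le> \<psi> x" and inc: "mono_on {0..} \<psi>"
    and summ: "summable (\<lambda>k. \<psi> (real k) / (1 + (real k)\<^sup>2))"
  shows "summable (\<lambda>m. \<psi> (2 ^ m) / 2 ^ m)"
proof (rule summableI_nonneg_bounded)
  fix Q
  have "(\<Sum>k<2 ^ Q. \<psi> (real k) / (1 + (real k)\<^sup>2)) \<le> (\<Sum>k. \<psi> (real k) / (1 + (real k)\<^sup>2))"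
    using summ nonneg by (intro sum_le_suminf) (auto simp: add_nonneg_nonneg)
  then show "(\<Sum>m<Q. \<psi> (2 ^ m) / 2 ^ m) \<le> 8 * (\<Sum>k. \<psi> (real k) / (1 + (real k)\<^sup>2))"
    using sum_dyadic_le[of \<psi> Q, OF nonneg inc] by linarith
qed (use nonneg in auto)

text \<open>On the dyadic block \<open>2^m \<le> \<bar>k\<bar> < 2^(m+1)\<close> the decay comes from the single factor with
  \<open>a = e / 2^m\<close>, which is at most \<open>1/e\<close> there; summability makes the total support small.\<close>

theorem weighted_kernel_vanishing:
  fixes \<psi> :: "real \<Rightarrow> real"
  assumes nonneg: "\<And>x. 0 \<le> x \<Longrightarrow> 0 \<le> \<psi> x" and inc: "mono_on {0..} \<psi>"
    and summ: "summable (\<lambda>k. \<psi> (real k) / (1 + (real k)\<^sup>2))"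
  shows "\<exists>(b :: int \<Rightarrow> real) W. b 0 = 1 \<and> (\<forall>k. 0 \<le> b k) \<and>
    (\<forall>A. finite A \<longrightarrow> (\<Sum>k\<in>A. b k * exp (\<psi> \<bar>real_of_int k\<bar>)) \<le> W) \<and>
    (\<forall>\<theta>\<in>{1..2 * pi - 1}.
      ((\<lambda>k. of_real (b k) * exp (\<i> * of_real (of_int k * \<theta>))) has_sum 0) UNIV)"
proof -
  \<comment> \<open>\<open>\<psi> (2 ^ Suc m)\<close> dominates \<open>\<psi>\<close> on block
    \<open>m\<close>; the extra \<open>Suc m\<close> supplies further decay of order
    \<open>1 / k^2\<close>, which makes the weighted coefficients summable.\<close>
  define q where "q m = nat \<lceil>\<psi> (2 ^ Suc m)\<rceil> + Suc m" for m
  have q_ge: "\<psi> (2 ^ Suc m) + real (Suc m) \<le> real (q m)" for m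
    unfolding q_def by (simp add: real_nat_ceiling_ge)
  have q_le: "real (q m) \<le> \<psi> (2 ^ Suc m) + real (m + 2)" for m
    unfolding q_def using nonneg[of "2 ^ Suc m"] by (simp add: of_nat_nat) linarith
  \<comment> \<open>Width contributed by block \<open>m\<close>: \<open>2 * q m\<close> averages of
    half-length \<open>exp 1 / 2 ^ m\<close>.\<close>
  define r where "r m = real (2 * q m) * (exp 1 / 2 ^ m)" for m
  have "summable r"
  proof (rule summable_comparison_test'[of _ 0])
    have "summable (\<lambda>m. \<psi> (2 ^ Suc m) / 2 ^ Suc m)"
      using summable_dyadic[OF nonneg inc summ] by (subst summable_Suc_iff)
    then show "summable (\<lambda>m. 4 * exp 1 * (\<psi> (2 ^ Suc m) / 2 ^ Suc m) + 8 * exp 1 * (3/4) ^ m)"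
      by (intro summable_add summable_mult summable_geometric) auto
    fix m :: nat
    \<comment> \<open>Trades the linear term of \<open>q\<close> for a geometric one;
      \<open>3/2 < 2\<close> leaves the ratio \<open>3/4\<close> after division by
      \<open>2 ^ m\<close>.\<close>
    have lin: "real (m + 2) \<le> 4 * (3/2) ^ m" for m
    proof (induction m)
      case (Suc m)
      moreover have "(1::real) \<le> (3/2) ^ m" by (intro one_le_power) auto
      ultimately show ?case by simp
    qed simp
    have "r m \<le> 2 * (\<psi> (2 ^ Suc m) + 4 * (3/2) ^ m) * (exp 1 / 2 ^ m)"
      unfolding r_def using q_le[of m] lin[of m] by (intro mult_right_mono) auto
    also have "\<dots> = 4 * exp 1 * (\<psi> (2 ^ Suc m) / 2 ^ Suc m) + 8 * exp 1 * ((3/2) ^ m / 2 ^ m)"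
      by (simp add: field_simps)
    also have "(3/2) ^ m / 2 ^ m = (3/4 :: real) ^ m" by (simp flip: power_divide)
    finally show "norm (r m) \<le> 4 * exp 1 * (\<psi> (2 ^ Suc m) / 2 ^ Suc m) + 8 * exp 1 * (3/4) ^ m"
      by (simp add: r_def)
  qed
  \<comment> \<open>Dropping the first \<open>m0\<close> blocks brings the total width below 1/2.
    The finitely many \<open>k\<close> with \<open>\<bar>k\<bar> < 2 ^ m0\<close> lose their decay
    factor and are paid for by the constant \<open>C\<close>.\<close>
  then obtain m0 where m0: "norm (\<Sum>i. r (i + m0)) < 1/2"
    using suminf_exist_split[of "1/2" r] by auto
  have total: "(\<Sum>m<Q. real (2 * q (m + m0)) * (exp 1 / 2 ^ (m + m0))) \<le> 1/2" for Q
  proof -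
    have "summable (\<lambda>i. r (i + m0))" using \<open>summable r\<close> by (simp only: summable_iff_shift)
    moreover have "0 \<le> r i" for i by (simp add: r_def)
    ultimately have "(\<Sum>m<Q. r (m + m0)) \<le> (\<Sum>i. r (i + m0))" by (intro sum_le_suminf) auto
    with m0 show ?thesis by (simp add: r_def)
  qed
  obtain b :: "int \<Rightarrow> real" where b: "\<And>k. 0 \<le> b k" "\<And>k. b k \<le> 1" "b 0 = 1"
    and b_le: "\<And>k m. b k \<le> sinc (exp 1 / 2 ^ (m + m0) * of_int k) ^ (2 * q (m + m0))"
    and b_cesaro: "\<And>\<theta>. \<theta> \<in> {1..2 * pi - 1} \<Longrightarrow> \<exists>C. \<forall>M. cmod (cesaro_exp_sum b M \<theta>) \<le> C"
    using sinc_product_kernel[of "\<lambda>m. exp 1 / 2 ^ (m + m0)" "\<lambda>m. q (m + m0)", OF _ total] by auto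
  define C where "C = exp (\<psi> (2 ^ m0)) * (1 + (2 ^ m0)\<^sup>2) + 2"
  have decay: "b k * exp (\<psi> \<bar>real_of_int k\<bar>) \<le> C * (1 / (1 + (real_of_int k)\<^sup>2))" for k
  proof (cases "\<bar>real_of_int k\<bar> < 2 ^ m0")
    case True
    then have "\<psi> \<bar>real_of_int k\<bar> \<le> \<psi> (2 ^ m0)" using mono_onD[OF inc, of "\<bar>real_of_int k\<bar>" "2 ^ m0"] by simp
    then have "b k * exp (\<psi> \<bar>real_of_int k\<bar>) \<le> 1 * exp (\<psi> (2 ^ m0))"
      using b by (intro mult_mono) auto
    moreover have "(real_of_int k)\<^sup>2 \<le> (2 ^ m0)\<^sup>2"
      using True by (simp add: abs_le_square_iff[symmetric])
    then have "exp (\<psi> (2 ^ m0)) * (1 + (real_of_int k)\<^sup>2) \<le> exp (\<psi> (2 ^ m0)) * (1 + (2 ^ m0)\<^sup>2)"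
      by (intro mult_left_mono) auto
    then have "exp (\<psi> (2 ^ m0)) * (1 + (real_of_int k)\<^sup>2) \<le> C" unfolding C_def by linarith
    then have "exp (\<psi> (2 ^ m0)) \<le> C / (1 + (real_of_int k)\<^sup>2)"
      by (simp add: pos_le_divide_eq add_pos_nonneg)
    ultimately show ?thesis by simp
  next
    case False
    define n where "n = nat \<bar>k\<bar>"
    have n: "real n = \<bar>real_of_int k\<bar>" by (simp add: n_def)
    have "real (2 ^ m0) \<le> real n" using False n by simp
    then have "2 ^ m0 \<le> n" by (simp only: of_nat_le_iff)
    moreover have "(1::nat) \<le> 2 ^ m0" by simp
    ultimately have "1 \<le> n" by linarith
    \<comment> \<open>The dyadic block of \<open>k\<close>. Since
      \<open>\<bar>k\<bar> \<ge> 2 ^ m0\<close>, it is one of the blocks kept, with index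
      \<open>m - m0\<close> in the shifted product.\<close>
    then obtain m where m: "2 ^ m \<le> n" "n < 2 ^ (m + 1)"
      using ex_power_ivl1[of 2 n] by auto
    have "2 ^ m0 < (2::nat) ^ (m + 1)" using m \<open>2 ^ m0 \<le> n\<close> by linarith
    then have "m0 < m + 1" by (rule power_less_imp_less_exp[rotated]) simp
    then have "m0 \<le> m" by simp
    have "real (2 ^ m) \<le> real n" "real n \<le> real (2 ^ (m + 1))" using m by (simp_all only: of_nat_le_iff less_imp_le)
    then have m': "2 ^ m \<le> real n" "real n \<le> 2 ^ Suc m" by simp_all
    let ?x = "exp 1 / 2 ^ m * real_of_int k"
    have x: "exp 1 \<le> \<bar>?x\<bar>"
      using m' by (simp add: abs_mult n[symmetric] field_simps)
    have "\<bar>sinc ?x\<bar> \<le> exp (- 1)"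
    proof -
      have "?x \<noteq> 0" using x by (metis abs_zero exp_gt_zero linorder_not_less)
      then have "\<bar>sinc ?x\<bar> \<le> 1 / \<bar>?x\<bar>" by (rule abs_sinc_le_inverse)
      also have "\<dots> \<le> 1 / exp 1" by (rule frac_le[OF zero_le_one order_refl exp_gt_zero x])
      finally show ?thesis by (simp add: exp_minus divide_inverse)
    qed
    then have "\<bar>sinc ?x\<bar> ^ (2 * q m) \<le> exp (- 1) ^ (2 * q m)" by (intro power_mono) auto
    also have "\<dots> = exp (- (2 * real (q m)))" by (simp flip: exp_of_nat_mult)
    finally have "b k \<le> exp (- (2 * real (q m)))"
      using b_le[of k "m - m0"] \<open>m0 \<le> m\<close> by (simp add: power_even_abs)
    also have "\<dots> \<le> exp (- \<psi> (real n) - 2 * real (Suc m))"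
    proof -
      have "\<psi> (real n) \<le> \<psi> (2 ^ Suc m)" using mono_onD[OF inc, of "real n" "2 ^ Suc m"] m' by simp
      with q_ge[of m] nonneg[of "2 ^ Suc m"] show ?thesis by simp
    qed
    also have "\<dots> = exp (- \<psi> (real n)) * exp (- real (Suc m)) ^ 2"
      by (simp add: power2_eq_square flip: exp_add)
    finally have "b k * exp (\<psi> (real n)) \<le> exp (- \<psi> (real n)) * exp (- real (Suc m)) ^ 2 * exp (\<psi> (real n))"
      by (intro mult_right_mono) auto
    also have "\<dots> = (exp (- real (Suc m)))\<^sup>2" by (simp add: exp_minus)
    also have "\<dots> \<le> (1 / real n)\<^sup>2"
    proof (intro power_mono)
      have "real n \<le> 2 ^ Suc m" by fact
      also have "\<dots> \<le> exp 1 ^ Suc m" using exp_ge_add_one_self[of 1] by (intro power_mono) auto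
      also have "\<dots> = exp (real (Suc m))" using exp_of_nat_mult[of "Suc m" "1::real"] by (simp only: mult_1_right)
      finally have "1 / exp (real (Suc m)) \<le> 1 / real n" using \<open>1 \<le> n\<close> by (intro divide_left_mono) auto
      then show "exp (- real (Suc m)) \<le> 1 / real n" by (simp only: exp_minus divide_inverse mult_1)
    qed auto
    also have "\<dots> \<le> 2 / (1 + (real n)\<^sup>2)"
    proof -
      have "1 \<le> (real n)\<^sup>2" using \<open>1 \<le> n\<close> by (simp add: one_le_power)
      moreover have "1 / y \<le> 2 / (1 + y)" if "1 \<le> y" for y :: real
        using that by (subst frac_le_eq) (auto intro!: divide_nonpos_pos)
      ultimately show ?thesis by (simp only: power_one power_divide)
    qed
    also have "\<dots> \<le> C / (1 + (real n)\<^sup>2)"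
      by (intro divide_right_mono) (auto simp: C_def add_nonneg_nonneg)
    finally show ?thesis by (simp add: n)
  qed
  have "0 \<le> C" by (simp add: C_def add_nonneg_nonneg)
  have sums: "(\<Sum>k\<in>A. b k * exp (\<psi> \<bar>real_of_int k\<bar>)) \<le> C * 5" if "finite A" for A
  proof -
    have "(\<Sum>k\<in>A. b k * exp (\<psi> \<bar>real_of_int k\<bar>)) \<le> C * (\<Sum>k\<in>A. 1 / (1 + (real_of_int k)\<^sup>2))"
      unfolding sum_distrib_left by (intro sum_mono decay)
    also have "\<dots> \<le> C * 5" using sum_int_inverse_square_le[OF that] \<open>0 \<le> C\<close> by (rule mult_left_mono)
    finally show ?thesis .
  qed
  have "(\<Sum>k\<in>A. \<bar>b k\<bar>) \<le> C * 5" if "finite A" for A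
  proof -
    have "(\<Sum>k\<in>A. \<bar>b k\<bar>) \<le> (\<Sum>k\<in>A. b k * exp (\<psi> \<bar>real_of_int k\<bar>))"
    proof (rule sum_mono)
      fix k
      have "b k * 1 \<le> b k * exp (\<psi> \<bar>real_of_int k\<bar>)"
        using b(1)[of k] nonneg[of "\<bar>real_of_int k\<bar>"] by (intro mult_left_mono) auto
      then show "\<bar>b k\<bar> \<le> b k * exp (\<psi> \<bar>real_of_int k\<bar>)" using b(1)[of k] by simp
    qed
    also have "\<dots> \<le> C * 5" by (rule sums[OF that])
    finally show ?thesis .
  qed
  note abs_sums = this
  show ?thesis
  proof (intro exI[of _ b] exI[of _ "C * 5"] conjI ballI)
    fix \<theta> :: real assume "\<theta> \<in> {1..2 * pi - 1}"
    then obtain c where "\<And>M. cmod (cesaro_exp_sum b M \<theta>) \<le> c" using b_cesaro by blast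
    with abs_sums show "((\<lambda>k. of_real (b k) * exp (\<i> * of_real (of_int k * \<theta>))) has_sum 0) UNIV"
      by (rule has_sum_zero_of_bounded_cesaro)
  qed (use b sums in auto)
qed

section \<open>Failure of density along one axis of the lattice\<close>

lemma lattice_vec_axis: "lattice_vec (axis j m) = of_int m *\<^sub>R axis j 1"
  by (simp add: lattice_vec_def axis_def vec_eq_iff)

lemma lattice_norm_axis: "lattice_norm (axis j m) = \<bar>real_of_int m\<bar>"
  by (simp add: lattice_norm_def lattice_vec_axis norm_axis_1)

text \<open>Pairing the restriction to axis \<open>j\<close> with the kernel coefficients is
  continuous for the weighted norm, as \<open>axis j m\<close> has norm
  \<open>\<bar>m\<bar>\<close>. It kills every exponential with frequency in
  \<open>\<Lambda>\<close>, yet takes the value 1 at the unit vector at 0.\<close>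

lemma not_dense_exp_span:
  fixes \<psi> :: "real \<Rightarrow> real"
  assumes nonneg: "\<And>x. 0 \<le> x \<Longrightarrow> 0 \<le> \<psi> x" and inc: "mono_on {0..} \<psi>"
    and summ: "summable (\<lambda>k. \<psi> (real k) / (1 + (real k)\<^sup>2))"
    and \<Lambda>: "\<And>l. l \<in> \<Lambda> \<Longrightarrow> l $ j \<in> {1..2 * pi - 1}"
  shows "\<not> dense_subspace \<psi> (exp_span (\<Lambda> :: (real ^ 'n::finite) set))"
proof
  assume dense: "dense_subspace \<psi> (exp_span \<Lambda>)"
  obtain b :: "int \<Rightarrow> real" and W where b: "b 0 = 1" "\<And>k. 0 \<le> b k"
    and W: "\<And>A. finite A \<Longrightarrow> (\<Sum>k\<in>A. b k * exp (\<psi> \<bar>real_of_int k\<bar>)) \<le> W"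
    and zero: "\<And>\<theta>. \<theta> \<in> {1..2 * pi - 1} \<Longrightarrow>
      ((\<lambda>k. of_real (b k) * exp (\<i> * of_real (of_int k * \<theta>))) has_sum 0) UNIV"
    using weighted_kernel_vanishing[OF nonneg inc summ] by blast
  have annihilates: "((\<lambda>m. of_real (b m) * g (axis j m)) has_sum 0) UNIV" if "g \<in> exp_span \<Lambda>" for g
    using that unfolding exp_span_def
  proof (induction rule: cfun.span_induct_alt)
    case base
    show ?case by simp
  next
    case (step c x y)
    then obtain l where l: "l \<in> \<Lambda>" "x = exp_family l" by auto
    have "((\<lambda>m. of_real (b m) * x (axis j m)) has_sum 0) UNIV"
      using zero[OF \<Lambda>[OF l(1)]] unfolding l(2) exp_family_def lattice_vec_axis
      by (simp add: inner_axis)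
    then have "((\<lambda>m. c * (of_real (b m) * x (axis j m)) + of_real (b m) * y (axis j m)) has_sum c * 0 + 0) UNIV"
      using step.IH by (intro has_sum_add has_sum_cmult_right)
    then show ?case by (simp add: cscale_def algebra_simps)
  qed
  define \<delta> where "\<delta> = (\<lambda>k :: int ^ 'n. if k = 0 then 1 else 0 :: complex)"
  have "0 < W"
    using W[of "{0}"] b(1) less_le_trans[OF exp_gt_zero[of "\<psi> 0"]] by simp
  have "\<delta> \<in> c_space \<psi>"
  proof -
    have "\<forall>\<^sub>F k in filtercomap lattice_norm at_top. \<delta> k / of_real (exp (\<psi> (lattice_norm k))) = 0"
      unfolding eventually_filtercomap
      by (rule exI[of _ "\<lambda>x. 0 < x"]) (auto simp: eventually_gt_at_top \<delta>_def lattice_norm_def lattice_vec_def zero_vec_def)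
    then show ?thesis unfolding c_space_def by (simp add: tendsto_eventually)
  qed
  \<comment> \<open>Distance below \<open>1 / (2 * W)\<close> allows the pairing with
    \<open>\<delta> - g\<close> at most 1/2. The pairing with \<open>g\<close> over a large finite
    set is below 1/2, so the two cannot add up to 1.\<close>
  then obtain g where g: "g \<in> exp_span \<Lambda>" "c_norm \<psi> (\<delta> - g) < 1 / (2 * W)"
    using dense \<open>0 < W\<close> unfolding dense_subspace_iff by (metis divide_pos_pos mult_pos_pos zero_less_numeral zero_less_one)
  have diff: "\<delta> - g \<in> c_space \<psi>"
    using dense g(1) \<open>\<delta> \<in> c_space \<psi>\<close> by (intro c_space_diff) (auto simp: dense_subspace_iff)
  have close: "cmod ((\<delta> - g) (axis j m)) \<le> 1 / (2 * W) * exp (\<psi> \<bar>real_of_int m\<bar>)" for m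
  proof -
    have "cmod ((\<delta> - g) (axis j m)) / exp (\<psi> (lattice_norm (axis j m :: int ^ 'n))) < 1 / (2 * W)"
      using c_norm_ge[OF diff] g(2) by (rule le_less_trans)
    then show ?thesis by (simp add: lattice_norm_axis divide_less_eq less_imp_le)
  qed
  have "\<forall>\<^sub>F A in finite_subsets_at_top UNIV. dist (\<Sum>m\<in>A. of_real (b m) * g (axis j m)) 0 < 1/2"
    using annihilates[OF g(1)] unfolding has_sum_def by (rule tendstoD) simp
  then obtain X where X: "finite X"
    "\<And>A. finite A \<Longrightarrow> X \<subseteq> A \<Longrightarrow> cmod (\<Sum>m\<in>A. of_real (b m) * g (axis j m)) < 1/2"
    unfolding eventually_finite_subsets_at_top by auto
  define A where "A = insert 0 X"
  have A: "finite A" "0 \<in> A" "cmod (\<Sum>m\<in>A. of_real (b m) * g (axis j m)) < 1/2"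
    using X by (auto simp: A_def)
  have "\<delta> (axis j m) = (if m = 0 then 1 else 0)" for m
    by (auto simp: \<delta>_def axis_def vec_eq_iff)
  then have "(\<Sum>m\<in>A. of_real (b m) * (\<delta> - g) (axis j m))
      = (\<Sum>m\<in>A. if m = 0 then of_real (b m) else 0) - (\<Sum>m\<in>A. of_real (b m) * g (axis j m))"
    by (simp add: right_diff_distrib sum_subtractf if_distrib[of "(*) _"] cong: if_cong)
  then have "1 = (\<Sum>m\<in>A. of_real (b m) * (\<delta> - g) (axis j m)) + (\<Sum>m\<in>A. of_real (b m) * g (axis j m))"
    using A b(1) by simp
  then have "1 \<le> cmod (\<Sum>m\<in>A. of_real (b m) * (\<delta> - g) (axis j m)) + cmod (\<Sum>m\<in>A. of_real (b m) * g (axis j m))"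
    by (metis norm_one norm_triangle_ineq)
  moreover have "cmod (\<Sum>m\<in>A. of_real (b m) * (\<delta> - g) (axis j m)) \<le> 1/2"
  proof -
    have "cmod (\<Sum>m\<in>A. of_real (b m) * (\<delta> - g) (axis j m))
        \<le> (\<Sum>m\<in>A. b m * (1 / (2 * W) * exp (\<psi> \<bar>real_of_int m\<bar>)))"
      by (rule order_trans[OF norm_sum], intro sum_mono, unfold norm_mult norm_of_real, intro mult_mono close)
        (auto simp: b(2) abs_of_nonneg)
    also have "\<dots> = 1 / (2 * W) * (\<Sum>m\<in>A. b m * exp (\<psi> \<bar>real_of_int m\<bar>))"
      by (simp add: sum_distrib_left mult_ac)
    also have "\<dots> \<le> 1 / (2 * W) * W" using W[OF A(1)] \<open>0 < W\<close> by (intro mult_left_mono) auto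
    finally show ?thesis using \<open>0 < W\<close> by simp
  qed
  ultimately show False using A(3) by linarith
qed

lemma suminf_ennreal_eq_top_iff:
  fixes f :: "nat \<Rightarrow> real"
  assumes "\<And>k. 0 \<le> f k"
  shows "(\<Sum>k. ennreal (f k)) = \<infinity> \<longleftrightarrow> \<not> summable f"
proof
  assume "(\<Sum>k. ennreal (f k)) = \<infinity>"
  moreover have "(\<Sum>k. ennreal (f k)) \<noteq> \<infinity>" if "summable f"
    using suminf_ennreal2[OF assms that] by simp
  ultimately show "\<not> summable f" by blast
next
  assume "\<not> summable f"
  then show "(\<Sum>k. ennreal (f k)) = \<infinity>"
    using summable_suminf_not_top[where f = f, OF assms] by auto
qed

theorem theorem3p2:
  fixes \<psi> :: "real \<Rightarrow> real"
  assumes nonneg: "\<And>x. 0 \<le> x \<Longrightarrow> 0 \<le> \<psi> x"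
    and increasing: "mono_on {0..} \<psi>"
    and unbounded: "filterlim \<psi> at_top at_top"
  shows "(\<forall>L :: 'n::finite \<Rightarrow> real set.
            (\<forall>j. L j \<subseteq> torus1 \<and> L j \<in> sets lebesgue \<and> emeasure lebesgue (L j) > 0) \<longrightarrow>
            dense_subspace \<psi> (exp_span (box_product L)))
         \<longleftrightarrow> (\<Sum>k. ennreal (\<psi> (real k) / (1 + (real k)\<^sup>2))) = \<infinity>"
proof -
  have "(\<Sum>k. ennreal (\<psi> (real k) / (1 + (real k)\<^sup>2))) = \<infinity>
      \<longleftrightarrow> \<not> summable (\<lambda>k. \<psi> (real k) / (1 + (real k)\<^sup>2))"
    using nonneg by (intro suminf_ennreal_eq_top_iff) (simp add: add_nonneg_nonneg)
  moreover have "dense_subspace \<psi> (exp_span (box_product L))"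
    if div: "\<not> summable (\<lambda>k. \<psi> (real k) / (1 + (real k)\<^sup>2))"
      and L: "\<forall>j. L j \<subseteq> torus1 \<and> L j \<in> sets lebesgue \<and> emeasure lebesgue (L j) > 0"
    for L :: "'n \<Rightarrow> real set"
  proof (rule dense_subspace_exp_span[OF unbounded exp_span_approx_delta[OF increasing]])
    fix j m and \<epsilon> :: real assume "0 < \<epsilon>"
    have "\<not> negligible (L j)"
      using L negligible_iff_emeasure0[of "L j"] by (metis less_irrefl)
    then show "\<exists>h\<in>cfun.span (line_exps (L j)).
        \<forall>k. cmod (h k - (if k = m then 1 else 0)) \<le> \<epsilon> * exp (\<psi> \<bar>real_of_int k\<bar>)"
      using L \<open>0 < \<epsilon>\<close> by (intro exp_line_span_approx_delta[OF nonneg increasing unbounded div]) auto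
  qed
  moreover have "\<exists>L :: 'n \<Rightarrow> real set. (\<forall>j. L j \<subseteq> torus1 \<and> L j \<in> sets lebesgue \<and> emeasure lebesgue (L j) > 0)
      \<and> \<not> dense_subspace \<psi> (exp_span (box_product L))"
    if summ: "summable (\<lambda>k. \<psi> (real k) / (1 + (real k)\<^sup>2))"
  proof (intro exI conjI allI)
    \<comment> \<open>The counterexample takes \<open>{1..<pi}\<close> in every coordinate: it lies
      in the zero set \<open>{1..2 * pi - 1}\<close> of the kernel and has positive measure.\<close>
    show "{1..<pi} \<subseteq> torus1" using pi_gt_zero by (auto simp: torus1_def)
    show "{1..<pi} \<in> sets lebesgue" by simp
    show "emeasure lebesgue {1..<pi} > 0" using pi_gt3 by simp
    show "\<not> dense_subspace \<psi> (exp_span (box_product (\<lambda>_ :: 'n. {1..<pi})))"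
    proof (rule not_dense_exp_span[OF nonneg increasing summ])
      fix l :: "real ^ 'n" assume "l \<in> box_product (\<lambda>_. {1..<pi})"
      \<comment> \<open>Any coordinate will do; \<open>undefined\<close> is some element of the
        index type, which is nonempty.\<close>
      then have "l $ undefined \<in> {1..<pi}" by (simp add: box_product_def)
      then show "l $ undefined \<in> {1..2 * pi - 1}" using pi_gt3 by simp
    qed
  qed
  ultimately show ?thesis by meson
qed

end
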